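(* The formula $$R^{\mathrm{SRD}}(D)=\frac12\log\left|AA^{T}+\frac{p}{D}\Sigma_{\mathbf w}\right|\qquad(\ast)$$ for the asymptotic sequential rate-distortion function of time-invariant $\mathbb{R}^p$-valued Gauss-Markov processes is not correct in general, even in the region of $D$ satisfying $$\frac{D}{p}\le\min_i\lambda_i\!\left(\frac{D}{p}AA^{T}+\Sigma_{\mathbf w}\right).\qquad(\ast\ast)$$ That is, there exist $p\ge1$, $A\in\mathbb{R}^{p\times p}$, covariance matrices $\Sigma_{\mathbf w}\succ0$ and $\Sigma_{\mathbf x_0}\succ0$ in $\mathbb{R}^{p\times p}$, and $D>0$ satisfying $(\ast\ast)$, such that for the process $\mathbf x_{t+1}=A\mathbf x_t+\mathbf w_t$, with $\mathbf x_0\sim\mathcal N(0,\Sigma_{\mathbf x_0})$ and white Gaussian noise $\mathbf w_t\sim\mathcal N(0,\Sigma_{\mathbf w})$ independent of $\mathbf x_0$, the equality $(\ast)$ fails.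
   Context: Here $|\cdot|$ denotes the determinant and $\lambda_i(\cdot)$ the $i$-th eigenvalue. Causal reconstruction: a reconstruction process $(\mathbf y_t)$ with values in $\mathbb{R}^p$ is specified by a sequence of conditional distributions (stochastic kernels) $\mathbf P(dy_t\mid y^{t-1},x^t)$, $t=0,1,\dots$, where $x^t=(x_0,\dots,x_t)$, $y^{t-1}=(y_0,\dots,y_{t-1})$, and for $t=0$ the kernel is $\mathbf P(dy_0\mid x_0)$. For a horizon $n$ write $\mathbf P(dy^n\|x^n)=\prod_{t=0}^n\mathbf P(dy_t\mid y^{t-1},x^t)$. The joint law of $(\mathbf x^n,\mathbf y^n)$ is $\mathbf P(dx^n)\otimes\mathbf P(dy^n\|x^n)$, where $\mathbf P(dx^n)$ is the given law of the source. Expectation and the mutual information $I(\mathbf x^n;\mathbf y^n)$ are taken with respect to this joint law. The logarithm base is the same in the mutual information and in $(\ast)$. Finite-time sequential rate-distortion (SRD) function: $$R^{\mathrm{SRD}}_{0,n}(D)=\inf_{\mathbf P(dy^n\|x^n)}\frac{1}{n+1}I(\mathbf x^n;\mathbf y^n)\quad\text{subject to}\quad \mathbb{E}\|\mathbf x_t-\mathbf y_t\|^2\le D\ \text{ for all } t=0,\dots,n,$$ with $\|\cdot\|$ the Euclidean norm. Asymptotic SRD function: $R^{\mathrm{SRD}}(D)=\lim_{n\to\infty}R^{\mathrm{SRD}}_{0,n}(D)$, provided the limit exists. *)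

theory Defs
  imports
    "HOL-Probability.Probability"
    "Jordan_Normal_Form.Gauss_Jordan_Elimination"
    "Jordan_Normal_Form.Spectral_Radius"
begin

hide_const (open) Determinants.det

text \<open>
  Since the dimension is existentially quantified in the theorem, it is a number p rather than a
  type.  A vector of R^p is an extensional function on \<^term>\<open>{..<p}\<close>; it is turned into a
  Jordan_Normal_Form vector by \<^const>\<open>vec\<close> whenever a matrix acts on it.
\<close>

type_synonym point = "nat \<Rightarrow> real"
type_synonym trajectory = "nat \<Rightarrow> point"

definition vec_space :: "nat \<Rightarrow> point measure" where
  "vec_space p = PiM {..<p} (\<lambda>_. borel)"

text \<open>Trajectories of length N, with times 0, ..., N - 1 (so horizon n is length n + 1).\<close>

definition traj_space :: "nat \<Rightarrow> nat \<Rightarrow> trajectory measure" where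
  "traj_space p N = PiM {..<N} (\<lambda>_. vec_space p)"

section \<open>Gauss-Markov source\<close>

definition pos_def_cov :: "nat \<Rightarrow> real mat \<Rightarrow> bool" where
  "pos_def_cov p S \<longleftrightarrow> S \<in> carrier_mat p p \<and> transpose_mat S = S \<and>
     (\<forall>v \<in> carrier_vec p. v \<noteq> 0\<^sub>v p \<longrightarrow> scalar_prod v (S *\<^sub>v v) > 0)"

definition gaussian_density :: "nat \<Rightarrow> real mat \<Rightarrow> point \<Rightarrow> real" where
  "gaussian_density p S z =
     exp (- scalar_prod (vec p z) (the (mat_inverse S) *\<^sub>v vec p z) / 2) / sqrt ((2 * pi) ^ p * det S)"

text \<open>The law N(0, S), for positive definite S.\<close>

definition gaussian :: "nat \<Rightarrow> real mat \<Rightarrow> point measure" where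
  "gaussian p S = density (PiM {..<p} (\<lambda>_. lborel)) (\<lambda>z. ennreal (gaussian_density p S z))"

text \<open>
  The process is realised on the space of its independent driving variables
  (x_0, w_0, w_1, ...): coordinate 0 is the initial state and coordinate t + 1 is w_t.
\<close>

definition gm_driving :: "nat \<Rightarrow> real mat \<Rightarrow> real mat \<Rightarrow> trajectory measure" where
  "gm_driving p S0 Sw = PiM UNIV (\<lambda>t. if t = 0 then gaussian p S0 else gaussian p Sw)"

primrec gm_process :: "nat \<Rightarrow> real mat \<Rightarrow> nat \<Rightarrow> trajectory \<Rightarrow> point" where
  "gm_process p A 0 \<omega> = \<omega> 0"
| "gm_process p A (Suc t) \<omega> =
     (\<lambda>i\<in>{..<p}. vec_index (A *\<^sub>v vec p (gm_process p A t \<omega>)) i + \<omega> (Suc t) i)"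

text \<open>For each length N, the law of (x_0, ..., x_(N - 1)).\<close>

definition gm_law :: "nat \<Rightarrow> real mat \<Rightarrow> real mat \<Rightarrow> real mat \<Rightarrow> nat \<Rightarrow> trajectory measure" where
  "gm_law p A S0 Sw N =
     distr (gm_driving p S0 Sw) (traj_space p N) (\<lambda>\<omega>. \<lambda>t\<in>{..<N}. gm_process p A t \<omega>)"

section \<open>Causal reconstructions\<close>

text \<open>
  \<open>K t (y, x)\<close> is the conditional law of y_t given the past reconstructions y_0, ..., y_(t - 1) and
  the source x_0, ..., x_t.  For t = 0 the space of past reconstructions has a single element.
\<close>

definition causal_kernels :: "nat \<Rightarrow> nat \<Rightarrow> (nat \<Rightarrow> trajectory \<times> trajectory \<Rightarrow> point measure) set" where
  "causal_kernels p N =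
     {K. \<forall>t<N. K t \<in> traj_space p t \<Otimes>\<^sub>M traj_space p (Suc t) \<rightarrow>\<^sub>M prob_algebra (vec_space p)}"

text \<open>The causally conditioned law P(dy^(N - 1) || x^(N - 1)), as the iterated product of the kernels.\<close>

primrec causal_law ::
  "nat \<Rightarrow> (nat \<Rightarrow> trajectory \<times> trajectory \<Rightarrow> point measure) \<Rightarrow> trajectory \<Rightarrow> nat \<Rightarrow> trajectory measure"
where
  "causal_law p K x 0 = return (traj_space p 0) (\<lambda>_. undefined)"
| "causal_law p K x (Suc t) =
     causal_law p K x t \<bind>
       (\<lambda>y. distr (K t (y, restrict x {..<Suc t})) (traj_space p (Suc t)) (\<lambda>v. y(t := v)))"

definition joint_law ::
  "nat \<Rightarrow> nat \<Rightarrow> trajectory measure \<Rightarrow> (nat \<Rightarrow> trajectory \<times> trajectory \<Rightarrow> point measure) \<Rightarrow>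
   (trajectory \<times> trajectory) measure"
where
  "joint_law p N P K =
     P \<bind> (\<lambda>x. distr (causal_law p K x N) (traj_space p N \<Otimes>\<^sub>M traj_space p N) (\<lambda>y. (x, y)))"

section \<open>Sequential rate-distortion function\<close>

text \<open>
  The library's mutual information is a Bochner integral, hence meaningless when the joint law is
  not absolutely continuous with respect to the product of its marginals, or when the log-density
  is not integrable.  In both cases the true value is infinite (the negative part of the
  log-density is always integrable with respect to the joint law).
\<close>

definition mutual_info :: "real \<Rightarrow> 'a measure \<Rightarrow> 'b measure \<Rightarrow> ('a \<times> 'b) measure \<Rightarrow> ereal" where
  "mutual_info b S T J =
     (let Q = distr J S fst \<Otimes>\<^sub>M distr J T snd in
      if absolutely_continuous Q J \<and> integrable J (entropy_density b Q J)
      then ereal (prob_space.mutual_information J b S T fst snd) else \<infinity>)"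

definition mean_sq_error :: "nat \<Rightarrow> nat \<Rightarrow> (trajectory \<times> trajectory) measure \<Rightarrow> ennreal" where
  "mean_sq_error p t J = (\<integral>\<^sup>+ (x, y). ennreal (\<Sum>i<p. (x t i - y t i)\<^sup>2) \<partial>J)"

text \<open>The source is given by the family P of the laws of its initial segments.\<close>

definition SRD_finite :: "real \<Rightarrow> nat \<Rightarrow> (nat \<Rightarrow> trajectory measure) \<Rightarrow> nat \<Rightarrow> real \<Rightarrow> ereal" where
  "SRD_finite b p P n D =
     (INF K \<in> {K \<in> causal_kernels p (Suc n).
                 \<forall>t\<le>n. mean_sq_error p t (joint_law p (Suc n) (P (Suc n)) K) \<le> ennreal D}.
        ereal (1 / (real n + 1)) *
        mutual_info b (traj_space p (Suc n)) (traj_space p (Suc n)) (joint_law p (Suc n) (P (Suc n)) K))"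

definition has_SRD :: "real \<Rightarrow> nat \<Rightarrow> (nat \<Rightarrow> trajectory measure) \<Rightarrow> real \<Rightarrow> real \<Rightarrow> bool" where
  "has_SRD b p P D R \<longleftrightarrow> (\<lambda>n. SRD_finite b p P n D) \<longlonglongrightarrow> ereal R"

end

theory Submission
  imports Defs "HOL-Real_Asymp.Real_Asymp"
begin

text \<open>
The formula is the value, at the error covariance \<open>\<Pi> = (D / p) I\<close>, of the objective
\<open>(1/2) log (det (A \<Pi> A\<^sup>T + \<Sigma>\<^sub>w) / det \<Pi>)\<close>, which ought to be minimised over all \<open>\<Pi>\<close>
of trace at most \<open>D\<close> with \<open>\<Pi> \<le> A \<Pi> A\<^sup>T + \<Sigma>\<^sub>w\<close>.  When \<open>A\<close> is not a multiple of an orthogonal matrix, a multiple of the identity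
need not be the minimiser.

The counterexample has \<open>p = 2\<close>, \<open>A = (0 1; 0 0)\<close>, \<open>\<Sigma>\<^sub>w = \<Sigma>\<^sub>0 = diag (1, 2)\<close> and
\<open>D = 3\<close>.  As \<open>A\<close> is nilpotent, the state is a finite-memory function of the noise:
\<open>x\<^sub>t = (u\<^sub>(\<^sub>t\<^sub>-\<^sub>1\<^sub>) + w\<^sub>t, u\<^sub>t)\<close>, where all \<open>u\<^sub>t ~ N(0, 2)\<close> and \<open>w\<^sub>t ~ N(0, 1)\<close> are
independent.  A good description of \<open>u\<^sub>t\<close> is used twice, once at time t and once as a prediction
of the first coordinate at time t + 1, so it pays to give the second coordinate the smaller error.
The optimal split of \<open>D = 3\<close> is 2 for the first coordinate and 1 for the second, where the first
coordinate costs no rate at all: the limit is \<open>(1/2) log 2\<close>, whereas the formula gives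
\<open>(1/2) log (20/9)\<close>.

Achievability: transmit \<open>u\<^sub>t\<close> through the Gaussian channel
\<open>y = u/2 + N(0, 1/2)\<close> with output variance and error 1, and repeat the output as first coordinate
at time t + 1.  The joint law has an explicit density with respect to the product of its
marginals (\<open>scheme_joint_density\<close>), from which the information is read off
(\<open>scheme_mutual_info\<close>).

Converse: let \<open>y = y\<^sub>t\<^sub>,\<^sub>1\<close> and \<open>z = y\<^sub>(\<^sub>t\<^sub>+\<^sub>1\<^sub>)\<^sub>,\<^sub>0\<close>.  For every positive h whose integral over the
source law is at most 1 for each reconstruction path, the information is at least
\<open>E (ln h)\<close> (\<open>mutual_info_ge\<close>).  Take for h the product over t of the densities of
\<open>u\<^sub>t ~ N((y + z)/2, 1)\<close> and \<open>w\<^sub>(\<^sub>t\<^sub>+\<^sub>1\<^sub>) ~ N((z - y)/2, 1)\<close> relative to their priors.  This is the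
backward channel of the optimal scheme, and the two squares in its exponent recombine as
\<open>((u + w - z)\<^sup>2 + (u - y - w)\<^sup>2) / 4\<close>.  The first expectation is a component of the distortion;
so is the second up to \<open>E w\<^sup>2 = 1\<close>, because causality makes the innovation \<open>w\<^sub>(\<^sub>t\<^sub>+\<^sub>1\<^sub>)\<close>
orthogonal to the error \<open>u\<^sub>t - y\<close> (\<open>nn_integral_innovation_flip\<close>).  Hence the bound depends
only on the total distortion, and only second moments of the reconstruction enter
(\<open>converse_bound\<close>).
\<close>

section \<open>Gaussian measures\<close>

definition centered_normal :: "real \<Rightarrow> real measure" where
  "centered_normal v = density lborel (normal_density 0 (sqrt v))"

lemma space_centered_normal [simp]: "space (centered_normal v) = UNIV"
  and sets_centered_normal [simp, measurable_cong]: "sets (centered_normal v) = sets borel"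
  by (simp_all add: centered_normal_def)

lemma prob_space_centered_normal: "0 < v \<Longrightarrow> prob_space (centered_normal v)"
  unfolding centered_normal_def by (rule prob_space_normal_density) simp

text \<open>
Measures on a finite product are determined by boxes, and on a box the integral of a product of
functions of the single coordinates factorises.
\<close>

lemma PiM_density_lborel:
  fixes f :: "'i \<Rightarrow> real \<Rightarrow> ennreal"
  assumes I: "finite I"
    and f [measurable]: "\<And>i. f i \<in> borel_measurable borel"
    and prob: "\<And>i. i \<in> I \<Longrightarrow> prob_space (density lborel (f i))"
  shows "density (PiM I (\<lambda>_. lborel)) (\<lambda>z. \<Prod>i\<in>I. f i (z i)) = PiM I (\<lambda>i. density lborel (f i))"
proof -
  interpret L: product_sigma_finite "\<lambda>_::'i. lborel :: real measure"
    by standard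
  \<comment> \<open>Product measures are indexed by a total family; outside I any probability measure will do.\<close>
  define M where "M i = (if i \<in> I then density lborel (f i) else return lborel 0)" for i
  interpret M: product_prob_space M
    unfolding M_def
    by (auto simp: product_prob_space_def product_prob_space_axioms_def product_sigma_finite_def
        intro!: prob_space_imp_sigma_finite prob prob_space_return)
  have "density (PiM I (\<lambda>_. lborel)) (\<lambda>z. \<Prod>i\<in>I. f i (z i)) = PiM I M"
  proof (rule M.PiM_eqI[OF I])
    show "sets (density (PiM I (\<lambda>_. lborel)) (\<lambda>z. \<Prod>i\<in>I. f i (z i))) = sets (PiM I M)"
      by (auto simp: M_def intro!: sets_PiM_cong)
  next
    fix B assume "\<And>i. i \<in> I \<Longrightarrow> B i \<in> sets (M i)"
    then have B [measurable]: "\<And>i. i \<in> I \<Longrightarrow> B i \<in> sets borel"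
      by (simp add: M_def)
    have PiE: "Pi\<^sub>E I B \<in> sets (PiM I (\<lambda>_. lborel))"
      using I B by (intro sets_PiM_I_finite) auto
    have "emeasure (density (PiM I (\<lambda>_. lborel)) (\<lambda>z. \<Prod>i\<in>I. f i (z i))) (Pi\<^sub>E I B)
        = (\<integral>\<^sup>+z. (\<Prod>i\<in>I. f i (z i)) * indicator (Pi\<^sub>E I B) z \<partial>PiM I (\<lambda>_. lborel))"
      using PiE by (intro emeasure_density) auto
    also have "\<dots> = (\<integral>\<^sup>+z. (\<Prod>i\<in>I. f i (z i) * indicator (B i) (z i)) \<partial>PiM I (\<lambda>_. lborel))"
    proof (rule nn_integral_cong)
      fix z :: "'i \<Rightarrow> real" assume "z \<in> space (PiM I (\<lambda>_. lborel))"
      then have "indicator (Pi\<^sub>E I B) z = (\<Prod>i\<in>I. indicator (B i) (z i) :: ennreal)"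
        using I by (auto simp: indicator_def space_PiM PiE_iff prod_zero_iff)
      then show "(\<Prod>i\<in>I. f i (z i)) * indicator (Pi\<^sub>E I B) z =
          (\<Prod>i\<in>I. f i (z i) * indicator (B i) (z i))"
        by (simp add: prod.distrib)
    qed
    also have "\<dots> = (\<Prod>i\<in>I. \<integral>\<^sup>+s. f i s * indicator (B i) s \<partial>lborel)"
      by (rule L.product_nn_integral_prod[OF I]) auto
    also have "\<dots> = (\<Prod>i\<in>I. emeasure (M i) (B i))"
      by (intro prod.cong refl) (simp add: M_def emeasure_density)
    finally show "emeasure (density (PiM I (\<lambda>_. lborel)) (\<lambda>z. \<Prod>i\<in>I. f i (z i))) (Pi\<^sub>E I B)
        = (\<Prod>i\<in>I. emeasure (M i) (B i))" .
  qed
  also have "PiM I M = PiM I (\<lambda>i. density lborel (f i))"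
    by (intro PiM_cong) (auto simp: M_def)
  finally show ?thesis .
qed

lemma mat_inverse_eq:
  fixes S :: "'a :: field mat"
  assumes S: "S \<in> carrier_mat n n" and B: "B \<in> carrier_mat n n"
    and BS: "B * S = 1\<^sub>m n" and SB: "S * B = 1\<^sub>m n"
  shows "mat_inverse S = Some B"
proof (cases "mat_inverse S")
  case None
  have "S \<in> Units (ring_mat TYPE('a) n ())"
    using S B BS SB by (auto simp: Units_def ring_mat_simps)
  with mat_inverse(1)[OF S None, of "()"] show ?thesis by simp
next
  case (Some C)
  from mat_inverse(2)[OF S Some] have C: "S * C = 1\<^sub>m n" "C \<in> carrier_mat n n" by auto
  have "C = (B * S) * C" using BS C by simp
  also have "\<dots> = B * (S * C)" using S B C by (intro assoc_mult_mat) auto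
  also have "\<dots> = B" using B C by simp
  finally show ?thesis using Some by simp
qed

lemma det_mat_diag: "det (mat_diag p v) = (\<Prod>i<p. v i :: 'a :: comm_ring_1)"
proof -
  have "upper_triangular (mat_diag p v)" by (auto simp: mat_diag_def upper_triangular_def)
  then have "det (mat_diag p v) = prod_list (diag_mat (mat_diag p v))"
    by (rule det_upper_triangular[where n = p]) (simp add: mat_diag_def)
  also have "diag_mat (mat_diag p v) = map v [0..<p]"
    by (auto simp: diag_mat_def mat_diag_def)
  also have "prod_list (map v [0..<p]) = (\<Prod>i<p. v i)"
    by (simp add: prod.distinct_set_conv_list[symmetric] atLeast0LessThan)
  finally show ?thesis .
qed

lemma spectrum_mat_diag: "spectrum (mat_diag p v) = (v ` {..<p} :: 'a :: field set)"
proof -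
  have c: "mat_diag p v \<in> carrier_mat p p" by (simp add: mat_diag_def)
  have ut: "upper_triangular (mat_diag p v)" by (auto simp: mat_diag_def upper_triangular_def)
  have "diag_mat (mat_diag p v) = map v [0..<p]"
    by (auto simp: diag_mat_def mat_diag_def)
  then show ?thesis
    unfolding spectrum_def
    by (auto simp: eigenvalue_root_char_poly[OF c] char_poly_upper_triangular[OF c ut]
        poly_prod_list prod_list_zero_iff)
qed

text \<open>
For a diagonal covariance the quadratic form is a sum and the determinant a product, so the joint
density splits into one-dimensional normal densities.
\<close>

lemma gaussian_mat_diag:
  assumes v: "\<And>i. i < p \<Longrightarrow> 0 < v i"
  shows "gaussian p (mat_diag p v) = PiM {..<p} (\<lambda>i. centered_normal (v i))"
proof -
  have inv: "mat_inverse (mat_diag p v) = Some (mat_diag p (\<lambda>i. 1 / v i))"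
  proof (rule mat_inverse_eq[where n = p])
    show "mat_diag p (\<lambda>i. 1 / v i) * mat_diag p v = 1\<^sub>m p"
      using v by (auto simp: mat_diag_diag intro!: eq_matI) (auto simp: mat_diag_def less_imp_neq dest!: v)
    show "mat_diag p v * mat_diag p (\<lambda>i. 1 / v i) = 1\<^sub>m p"
      using v by (auto simp: mat_diag_diag intro!: eq_matI) (auto simp: mat_diag_def dest!: v)
  qed (simp_all add: mat_diag_def)
  have dens: "gaussian_density p (mat_diag p v) z = (\<Prod>i<p. normal_density 0 (sqrt (v i)) (z i))" for z
  proof -
    have "mat_diag p (\<lambda>i. 1 / v i) *\<^sub>v vec p z = vec p (\<lambda>i. z i / v i)"
      by (rule eq_vecI) (auto simp: mat_diag_def scalar_prod_def if_distrib[of "\<lambda>x. x * _"]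
          sum.delta cong: if_cong)
    then have "scalar_prod (vec p z) (mat_diag p (\<lambda>i. 1 / v i) *\<^sub>v vec p z) = (\<Sum>i<p. (z i)\<^sup>2 / v i)"
      by (simp add: scalar_prod_def atLeast0LessThan power2_eq_square)
    then have "gaussian_density p (mat_diag p v) z =
        exp (\<Sum>i<p. - ((z i)\<^sup>2 / (2 * v i))) / sqrt (\<Prod>i<p. 2 * pi * v i)"
      unfolding gaussian_density_def inv
      by (simp add: det_mat_diag prod.distrib sum_negf sum_divide_distrib mult.commute)
    also have "\<dots> = (\<Prod>i<p. exp (- ((z i)\<^sup>2 / (2 * v i))) / sqrt (2 * pi * v i))"
    proof -
      have "sqrt (\<Prod>i<p. 2 * pi * v i) = (\<Prod>i<p. sqrt (2 * pi * v i))"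
        by (induction p) (simp_all add: real_sqrt_mult)
      then show ?thesis by (simp add: exp_sum prod_dividef)
    qed
    also have "\<dots> = (\<Prod>i<p. normal_density 0 (sqrt (v i)) (z i))"
      using v by (intro prod.cong refl) (simp add: normal_density_def less_imp_le)
    finally show ?thesis .
  qed
  have "gaussian p (mat_diag p v) = density (PiM {..<p} (\<lambda>_. lborel))
      (\<lambda>z. \<Prod>i<p. ennreal (normal_density 0 (sqrt (v i)) (z i)))"
    unfolding gaussian_def dens by (simp add: prod_ennreal)
  also have "\<dots> = PiM {..<p} (\<lambda>i. density lborel (normal_density 0 (sqrt (v i))))"
    by (rule PiM_density_lborel) (auto intro!: prob_space_normal_density v)
  finally show ?thesis unfolding centered_normal_def .
qed

lemma measurable_centered_normal [simp]:
  "measurable (centered_normal v) N = measurable borel N"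
  "measurable M (centered_normal v) = measurable M borel"
  by (rule measurable_cong_sets; simp)+

lemma nn_integral_centered_normal:
  "f \<in> borel_measurable borel \<Longrightarrow>
    (\<integral>\<^sup>+s. f s \<partial>centered_normal v) = (\<integral>\<^sup>+s. ennreal (normal_density 0 (sqrt v) s) * f s \<partial>lborel)"
  unfolding centered_normal_def by (subst nn_integral_density) auto

lemma nn_integral_centered_normal_square:
  assumes "0 < v"
  shows "(\<integral>\<^sup>+s. ennreal ((c - s)\<^sup>2) \<partial>centered_normal v) = ennreal (c\<^sup>2 + v)"
proof -
  let ?d = "normal_density 0 (sqrt v)"
  have m0: "has_bochner_integral lborel ?d 1"
    using has_bochner_integral_integrable[OF integrable_normal_density[of "sqrt v" 0]] assms by simp
  have m1: "has_bochner_integral lborel (\<lambda>s. ?d s * s) 0"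
    using assms by (intro normal_moment_nz_1) simp
  have m2: "has_bochner_integral lborel (\<lambda>s. ?d s * s\<^sup>2) v"
    using normal_moment_even[of "sqrt v" 0 1] assms by simp
  have "has_bochner_integral lborel (\<lambda>s. c\<^sup>2 * ?d s - 2 * c * (?d s * s) + ?d s * s\<^sup>2) (c\<^sup>2 * 1 - 2 * c * 0 + v)"
    by (intro has_bochner_integral_add has_bochner_integral_diff has_bochner_integral_mult_right m0 m1 m2)
  also have "(\<lambda>s. c\<^sup>2 * ?d s - 2 * c * (?d s * s) + ?d s * s\<^sup>2) = (\<lambda>s. ?d s * (c - s)\<^sup>2)"
    by (auto simp: power2_eq_square algebra_simps)
  finally have "(\<integral>\<^sup>+s. ennreal (?d s * (c - s)\<^sup>2) \<partial>lborel) = ennreal (c\<^sup>2 + v)"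
    using assms by (subst nn_integral_eq_integral) (auto simp: has_bochner_integral_iff)
  then show ?thesis by (simp add: nn_integral_centered_normal ennreal_mult)
qed

text \<open>
The density of \<open>N(\<mu>, 1)\<close> relative to \<open>N(0, v)\<close>.  Both the test functions of the converse
and the joint density of the optimal scheme are products of such ratios.
\<close>

definition lik_ratio :: "real \<Rightarrow> real \<Rightarrow> real \<Rightarrow> real" where
  "lik_ratio v \<mu> s = normal_density \<mu> 1 s / normal_density 0 (sqrt v) s"

lemma lik_ratio_measurable [measurable]:
  assumes "f \<in> borel_measurable M" "g \<in> borel_measurable M"
  shows "(\<lambda>z. lik_ratio v (f z) (g z)) \<in> borel_measurable M"
  using assms unfolding lik_ratio_def normal_density_def by measurable

lemma lik_ratio_pos: "0 < v \<Longrightarrow> 0 < lik_ratio v \<mu> s"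
  by (simp add: lik_ratio_def normal_density_pos)

lemma ln_lik_ratio:
  assumes "0 < v"
  shows "ln (lik_ratio v \<mu> s) = ln v / 2 + s\<^sup>2 / (2 * v) - (s - \<mu>)\<^sup>2 / 2"
proof -
  have "lik_ratio v \<mu> s = sqrt v * exp (s\<^sup>2 / (2 * v) - (s - \<mu>)\<^sup>2 / 2)"
  proof -
    have "exp (s\<^sup>2 / (2 * v) - (s - \<mu>)\<^sup>2 / 2) = exp (- (s - \<mu>)\<^sup>2 / 2) / exp (- s\<^sup>2 / (2 * v))"
      by (simp add: exp_diff[symmetric])
    then show ?thesis
      using assms by (simp add: lik_ratio_def normal_density_def real_sqrt_mult)
  qed
  then show ?thesis using assms by (simp add: ln_mult ln_sqrt)
qed

lemma nn_integral_lik_ratio: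
  assumes "0 < v"
  shows "(\<integral>\<^sup>+s. ennreal (lik_ratio v \<mu> s) \<partial>centered_normal v) = 1"
proof -
  have "ennreal (normal_density 0 (sqrt v) s) * ennreal (lik_ratio v \<mu> s) = ennreal (normal_density \<mu> 1 s)" for s
    using normal_density_pos[of "sqrt v" 0 s] assms
    by (simp add: lik_ratio_def ennreal_mult[symmetric])
  then show ?thesis
    by (simp add: nn_integral_centered_normal nn_integral_eq_integral)
qed

text \<open>
Applied at two levels, to the coordinates of one noise vector and to the sequence of noise vectors,
this makes the sign change of a single noise component measure-preserving.
\<close>

lemma distr_PiM_update:
  assumes M: "product_prob_space M" and I: "finite I" "t \<in> I"
    and \<phi> [measurable]: "\<phi> \<in> M t \<rightarrow>\<^sub>M M t" and inv: "distr (M t) (M t) \<phi> = M t"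
  shows "(\<lambda>w. w(t := \<phi> (w t))) \<in> PiM I M \<rightarrow>\<^sub>M PiM I M"
    and "distr (PiM I M) (PiM I M) (\<lambda>w. w(t := \<phi> (w t))) = PiM I M"
proof -
  interpret product_prob_space M by fact
  let ?U = "\<lambda>w. w(t := \<phi> (w t))"
  have "(\<lambda>\<omega>. \<phi> (\<omega> t)) \<in> PiM I M \<rightarrow>\<^sub>M M t" using I by measurable
  then have "?U \<in> PiM I M \<rightarrow>\<^sub>M PiM (insert t I) M"
    by (intro measurable_fun_upd[where J = I]) (use I in auto)
  then show U: "?U \<in> PiM I M \<rightarrow>\<^sub>M PiM I M" using I by (simp add: insert_absorb)
  show "distr (PiM I M) (PiM I M) ?U = PiM I M"
  proof (rule PiM_eqI[OF I(1)])
    fix A assume A: "\<And>i. i \<in> I \<Longrightarrow> A i \<in> sets (M i)"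
    let ?B = "A(t := \<phi> -` A t \<inter> space (M t))"
    have B: "?B i \<in> sets (M i)" if "i \<in> I" for i
      using A[OF that] A[OF I(2)] by (auto intro: measurable_sets[OF \<phi>])
    have "?U -` Pi\<^sub>E I A \<inter> space (PiM I M) = Pi\<^sub>E I ?B"
    proof (rule subset_antisym; rule subsetI)
      fix \<omega> assume "\<omega> \<in> ?U -` Pi\<^sub>E I A \<inter> space (PiM I M)"
      then show "\<omega> \<in> Pi\<^sub>E I ?B"
        using I by (auto simp: space_PiM PiE_iff split: if_splits)
    next
      fix \<omega> assume \<omega>: "\<omega> \<in> Pi\<^sub>E I ?B"
      then have "\<omega> i \<in> ?B i" if "i \<in> I" for i using that by (auto simp: PiE_iff)
      then have "\<omega> i \<in> space (M i)" if "i \<in> I" for i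
        using sets.sets_into_space[OF B[OF that]] that by blast
      then show "\<omega> \<in> ?U -` Pi\<^sub>E I A \<inter> space (PiM I M)"
        using \<omega> I by (auto simp: space_PiM PiE_iff extensional_def split: if_splits)
    qed
    then have "emeasure (distr (PiM I M) (PiM I M) ?U) (Pi\<^sub>E I A) = emeasure (PiM I M) (Pi\<^sub>E I ?B)"
      using U A I by (subst emeasure_distr) (auto intro!: sets_PiM_I_finite)
    also have "\<dots> = (\<Prod>i\<in>I. emeasure (M i) (?B i))"
      using B I by (intro emeasure_PiM) auto
    also have "\<dots> = (\<Prod>i\<in>I. emeasure (M i) (A i))"
    proof (intro prod.cong refl)
      fix i assume "i \<in> I"
      have "emeasure (M t) (\<phi> -` A t \<inter> space (M t)) = emeasure (distr (M t) (M t) \<phi>) (A t)"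
        using A[OF I(2)] by (simp add: emeasure_distr)
      then show "emeasure (M i) (?B i) = emeasure (M i) (A i)" by (simp add: inv)
    qed
    finally show "emeasure (distr (PiM I M) (PiM I M) ?U) (Pi\<^sub>E I A) = (\<Prod>i\<in>I. emeasure (M i) (A i))" .
  qed simp
qed

lemma distr_uminus_centered_normal: "distr (centered_normal v) (centered_normal v) uminus = centered_normal v"
proof (rule measure_eqI)
  fix A assume "A \<in> sets (distr (centered_normal v) (centered_normal v) uminus)"
  then have A [measurable]: "A \<in> sets borel" by simp
  have "emeasure (distr (centered_normal v) (centered_normal v) uminus) A
      = (\<integral>\<^sup>+s. indicator A (- s) \<partial>centered_normal v)"
    by (subst nn_integral_indicator[symmetric], simp, subst nn_integral_distr) auto
  also have "\<dots> = (\<integral>\<^sup>+s. ennreal (normal_density 0 (sqrt v) s) * indicator A (- s) \<partial>lborel)"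
    by (rule nn_integral_centered_normal) measurable
  also have "\<dots> = (\<integral>\<^sup>+s. ennreal (normal_density 0 (sqrt v) s) * indicator A s \<partial>lborel)"
    by (subst nn_integral_real_affine[where c = "- 1" and t = 0])
      (simp_all add: normal_density_def)
  also have "\<dots> = emeasure (centered_normal v) A"
    by (subst nn_integral_centered_normal[symmetric]) simp_all
  finally show "emeasure (distr (centered_normal v) (centered_normal v) uminus) A = emeasure (centered_normal v) A" .
qed simp

section \<open>Lower bound and density formula for mutual information\<close>

text \<open>
The variational bound behind the converse.  If \<open>f\<close> is the density of the joint law with
respect to the product of its marginals, then \<open>ln f - ln h = - ln (h / f)\<close> is at least
\<open>1 - h / f\<close>, and the expectation of \<open>h / f\<close> is the integral of \<open>h\<close> against the product
measure over \<open>{f > 0}\<close>, hence at most 1.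
\<close>

lemma mutual_info_ge:
  fixes h :: "'a \<times> 'b \<Rightarrow> real"
  assumes b: "1 < b" and J: "prob_space J" and sets_J: "sets J = sets (S \<Otimes>\<^sub>M T)"
    and h [measurable]: "h \<in> borel_measurable (S \<Otimes>\<^sub>M T)" and pos: "\<And>z. 0 < h z"
    and le1: "\<And>y. y \<in> space T \<Longrightarrow> (\<integral>\<^sup>+x. ennreal (h (x, y)) \<partial>distr J S fst) \<le> 1"
    and int: "integrable J (\<lambda>z. ln (h z))"
  shows "ereal ((\<integral>z. ln (h z) \<partial>J) / ln b) \<le> mutual_info b S T J"
proof -
  interpret J: prob_space J by fact
  note [measurable_cong] = sets_J
  have fst_J [measurable]: "fst \<in> J \<rightarrow>\<^sub>M S" and snd_J [measurable]: "snd \<in> J \<rightarrow>\<^sub>M T"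
    by measurable
  define PX PY Q where "PX = distr J S fst" and "PY = distr J T snd" and "Q = PX \<Otimes>\<^sub>M PY"
  interpret PX: prob_space PX unfolding PX_def by (rule J.prob_space_distr) simp
  interpret PY: prob_space PY unfolding PY_def by (rule J.prob_space_distr) simp
  interpret PXY: pair_prob_space PX PY ..
  have [measurable_cong]: "sets PX = sets S" "sets PY = sets T" by (simp_all add: PX_def PY_def)
  have sets_Q [measurable_cong]: "sets Q = sets (S \<Otimes>\<^sub>M T)"
    unfolding Q_def by (intro sets_pair_measure_cong) (simp_all add: PX_def PY_def)
  interpret Q: prob_space Q unfolding Q_def by unfold_locales
  show ?thesis
  proof (cases "absolutely_continuous Q J \<and> integrable J (entropy_density b Q J)")
    case False
    then show ?thesis unfolding mutual_info_def Let_def Q_def PX_def PY_def by auto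
  next
    case True
    then have ac: "absolutely_continuous Q J" and intJ: "integrable J (entropy_density b Q J)" by auto
    define f where "f z = enn2real (RN_deriv Q J z)" for z
    have [measurable]: "RN_deriv Q J \<in> borel_measurable (S \<Otimes>\<^sub>M T)"
      using borel_measurable_RN_deriv[of Q J] by (simp cong: measurable_cong_sets)
    have f [measurable]: "f \<in> borel_measurable (S \<Otimes>\<^sub>M T)" unfolding f_def by measurable
    have J_eq: "density Q (RN_deriv Q J) = J"
      by (rule Q.density_RN_deriv[OF ac]) (simp add: sets_J sets_Q)
    have "AE z in Q. RN_deriv Q J z \<noteq> \<infinity>"
      by (rule Q.RN_deriv_finite[OF _ ac]) (simp_all add: sets_J sets_Q J.sigma_finite_measure_axioms)
    then have "AE z in density Q (RN_deriv Q J). 0 < RN_deriv Q J z \<and> RN_deriv Q J z \<noteq> \<infinity>"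
      by (subst AE_density) auto
    then have f_pos: "AE z in J. 0 < f z"
      unfolding J_eq by eventually_elim (auto simp: f_def enn2real_positive_iff less_top)
    have "(\<integral>\<^sup>+z. ennreal (h z / f z) \<partial>J) = (\<integral>\<^sup>+z. RN_deriv Q J z * ennreal (h z / f z) \<partial>Q)"
      by (subst J_eq[symmetric], rule nn_integral_density) measurable
    also have "\<dots> \<le> (\<integral>\<^sup>+z. ennreal (h z) \<partial>Q)"
    proof (rule nn_integral_mono)
      fix z
      show "RN_deriv Q J z * ennreal (h z / f z) \<le> ennreal (h z)"
      proof (cases "RN_deriv Q J z")
        case (real r)
        then show ?thesis using pos[of z]
          by (cases "r = 0") (simp_all add: f_def ennreal_mult[symmetric])
      qed (simp add: f_def)
    qed
    also have "\<dots> = (\<integral>\<^sup>+y. \<integral>\<^sup>+x. ennreal (h (x, y)) \<partial>PX \<partial>PY)"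
      unfolding Q_def by (subst PXY.nn_integral_snd[symmetric]) (auto simp: comp_def)
    also have "\<dots> \<le> (\<integral>\<^sup>+y. 1 \<partial>PY)"
      using le1 by (intro nn_integral_mono) (simp add: PX_def PY_def)
    also have "\<dots> = 1" by (simp add: PY.emeasure_space_1)
    finally have hf: "(\<integral>\<^sup>+z. ennreal (h z / f z) \<partial>J) \<le> 1" .
    have hf_nn: "0 \<le> h z / f z" for z using pos[of z] by (simp add: f_def less_imp_le)
    have hf_meas [measurable]: "(\<lambda>z. h z / f z) \<in> borel_measurable J" by measurable
    have hf_int: "integrable J (\<lambda>z. h z / f z)"
      using hf hf_nn by (intro integrableI_nonneg) (auto simp: order.strict_trans1)
    have "(\<integral>z. h z / f z \<partial>J) = enn2real (\<integral>\<^sup>+z. ennreal (h z / f z) \<partial>J)"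
      using hf_nn by (intro integral_eq_nn_integral) auto
    also have "\<dots> \<le> 1" using hf by (metis enn2real_1 enn2real_mono ennreal_one_less_top)
    finally have hf_le: "(\<integral>z. h z / f z \<partial>J) \<le> 1" .
    have ed: "entropy_density b Q J z = ln (f z) / ln b" for z
      by (simp add: entropy_density_def f_def log_def)
    have f_int: "integrable J (\<lambda>z. ln (f z))"
    proof -
      have "integrable J (\<lambda>z. ln b * entropy_density b Q J z)" using intJ by simp
      then show ?thesis using b by (simp add: ed)
    qed
    have "(\<integral>z. ln (h z) \<partial>J) \<le> (\<integral>z. ln (h z) + 1 - h z / f z \<partial>J)"
      using hf_le by (simp add: int hf_int J.prob_space)
    also have "\<dots> \<le> (\<integral>z. ln (f z) \<partial>J)"
    proof (rule integral_mono_AE)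
      show "AE z in J. ln (h z) + 1 - h z / f z \<le> ln (f z)"
        using f_pos
      proof eventually_elim
        case (elim z)
        have "ln (h z / f z) \<le> h z / f z - 1"
          using pos[of z] elim by (intro ln_le_minus_one) simp
        then show ?case using pos[of z] elim by (simp add: ln_div)
      qed
    qed (simp_all add: int hf_int f_int)
    finally have le: "(\<integral>z. ln (h z) \<partial>J) / ln b \<le> (\<integral>z. ln (f z) \<partial>J) / ln b"
      using b by (simp add: divide_right_mono)
    have "distr J (S \<Otimes>\<^sub>M T) (\<lambda>x. (fst x, snd x)) = J"
      using distr_id2[of "S \<Otimes>\<^sub>M T" J] by (simp add: sets_J)
    then have "mutual_info b S T J = ereal (\<integral>z. entropy_density b Q J z \<partial>J)"
      using True
      by (simp add: mutual_info_def Let_def Q_def PX_def PY_def J.mutual_information_def KL_divergence_def)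
    then show ?thesis using le by (simp add: ed)
  qed
qed

text \<open>
The two normalisations of \<open>f\<close> say that \<open>PX\<close> and \<open>PY\<close> are the marginals of the joint law;
then \<open>f\<close> is the Radon-Nikodym derivative that defines the information.
\<close>

lemma mutual_info_density:
  fixes f :: "'a \<times> 'b \<Rightarrow> real"
  assumes b: "1 < b" and PX: "prob_space PX" and PY: "prob_space PY"
    and setsX: "sets PX = sets S" and setsY: "sets PY = sets T"
    and f [measurable]: "f \<in> borel_measurable (PX \<Otimes>\<^sub>M PY)" and pos: "\<And>z. 0 < f z"
    and f_x: "\<And>x. x \<in> space PX \<Longrightarrow> (\<integral>\<^sup>+y. ennreal (f (x, y)) \<partial>PY) = 1"
    and f_y: "\<And>y. y \<in> space PY \<Longrightarrow> (\<integral>\<^sup>+x. ennreal (f (x, y)) \<partial>PX) = 1"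
    and J_eq: "J = density (PX \<Otimes>\<^sub>M PY) (\<lambda>z. ennreal (f z))"
    and int: "integrable J (\<lambda>z. ln (f z))"
  shows "mutual_info b S T J = ereal ((\<integral>z. ln (f z) \<partial>J) / ln b)"
proof -
  interpret PX: prob_space PX by fact
  interpret PY: prob_space PY by fact
  interpret PXY: pair_prob_space PX PY ..
  define Q where "Q = PX \<Otimes>\<^sub>M PY"
  interpret Q: prob_space Q unfolding Q_def by unfold_locales
  have sets_ST: "sets (S \<Otimes>\<^sub>M T) = sets (PX \<Otimes>\<^sub>M PY)"
    using setsX setsY by (intro sets_pair_measure_cong) auto
  have sets_J: "sets J = sets (PX \<Otimes>\<^sub>M PY)" by (simp add: J_eq)
  note [measurable_cong] = sets_J
  have fst_J: "distr J S fst = PX"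
  proof -
    have "distr J PX fst = PX"
    proof (rule measure_eqI)
      fix A assume "A \<in> sets (distr J PX fst)"
      then have A [measurable]: "A \<in> sets PX" by simp
      have "emeasure (distr J PX fst) A = (\<integral>\<^sup>+z. indicator A (fst z) \<partial>J)"
        by (subst nn_integral_indicator[symmetric], simp, subst nn_integral_distr) auto
      also have "\<dots> = (\<integral>\<^sup>+z. ennreal (f z) * indicator A (fst z) \<partial>(PX \<Otimes>\<^sub>M PY))"
        unfolding J_eq by (rule nn_integral_density) auto
      also have "\<dots> = (\<integral>\<^sup>+x. \<integral>\<^sup>+y. ennreal (f (x, y)) * indicator A x \<partial>PY \<partial>PX)"
        by (subst PY.nn_integral_fst[symmetric]) auto
      also have "\<dots> = (\<integral>\<^sup>+x. indicator A x \<partial>PX)"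
        by (rule nn_integral_cong) (simp add: nn_integral_multc f_x)
      finally show "emeasure (distr J PX fst) A = emeasure PX A" by simp
    qed simp
    moreover have "distr J S fst = distr J PX fst" by (rule distr_cong) (simp_all add: setsX)
    ultimately show ?thesis by simp
  qed
  have snd_J: "distr J T snd = PY"
  proof -
    have "distr J PY snd = PY"
    proof (rule measure_eqI)
      fix A assume "A \<in> sets (distr J PY snd)"
      then have A [measurable]: "A \<in> sets PY" by simp
      have "emeasure (distr J PY snd) A = (\<integral>\<^sup>+z. indicator A (snd z) \<partial>J)"
        by (subst nn_integral_indicator[symmetric], simp, subst nn_integral_distr) auto
      also have "\<dots> = (\<integral>\<^sup>+z. ennreal (f z) * indicator A (snd z) \<partial>(PX \<Otimes>\<^sub>M PY))"
        unfolding J_eq by (rule nn_integral_density) auto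
      also have "\<dots> = (\<integral>\<^sup>+y. \<integral>\<^sup>+x. ennreal (f (x, y)) * indicator A y \<partial>PX \<partial>PY)"
        by (subst PXY.nn_integral_snd[symmetric]) auto
      also have "\<dots> = (\<integral>\<^sup>+y. indicator A y \<partial>PY)"
        by (rule nn_integral_cong) (simp add: nn_integral_multc f_y)
      finally show "emeasure (distr J PY snd) A = emeasure PY A" by simp
    qed simp
    moreover have "distr J T snd = distr J PY snd" by (rule distr_cong) (simp_all add: setsY)
    ultimately show ?thesis by simp
  qed
  have J: "prob_space J"
  proof -
    have "emeasure J (space J) = emeasure (distr J S fst) (space PX)"
      by (subst emeasure_distr)
        (auto simp: measurable_cong_sets[OF sets_J setsX[symmetric]]
          sets_eq_imp_space_eq[OF sets_J] space_pair_measure intro!: arg_cong[where f = "emeasure J"]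
          simp flip: setsX)
    then show ?thesis unfolding fst_J by (intro prob_spaceI) (simp add: PX.emeasure_space_1)
  qed
  interpret J: prob_space J by fact
  have J_Q: "J = density Q (\<lambda>z. ennreal (f z))" by (simp add: J_eq Q_def)
  have fQ [measurable]: "f \<in> borel_measurable Q" by (simp add: Q_def)
  have ac: "absolutely_continuous Q J"
    unfolding J_Q by (rule absolutely_continuousI_density) auto
  have RN: "AE z in Q. RN_deriv Q J z = ennreal (f z)"
    by (rule AE_symmetric, rule Q.RN_deriv_unique) (auto simp: J_Q)
  have "AE z in J. RN_deriv Q J z = ennreal (f z)"
    by (rule absolutely_continuous_AE[OF _ ac RN]) (simp add: sets_J Q_def)
  then have ed: "AE z in J. entropy_density b Q J z = ln (f z) / ln b"
    by eventually_elim (use pos in \<open>auto simp: entropy_density_def log_def less_imp_le\<close>)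
  have ed_meas [measurable]: "entropy_density b Q J \<in> borel_measurable J"
    using measurable_entropy_density[of b Q J]
    by (simp add: measurable_cong_sets[OF sets_J refl] Q_def)
  have int': "integrable J (\<lambda>z. ln (f z) / ln b)" using int by simp
  have ed_int: "integrable J (entropy_density b Q J)"
    by (rule iffD2[OF integrable_cong_AE[OF _ _ ed] int']) measurable
  have "(\<integral>z. entropy_density b Q J z \<partial>J) = (\<integral>z. ln (f z) / ln b \<partial>J)"
    by (rule integral_cong_AE[OF _ _ ed]) measurable
  moreover have "distr J (S \<Otimes>\<^sub>M T) (\<lambda>x. (fst x, snd x)) = J"
    using distr_id2[of "S \<Otimes>\<^sub>M T" J] by (simp add: sets_J sets_ST)
  ultimately show ?thesis
    using ac ed_int
    by (simp add: mutual_info_def Let_def fst_J snd_J J.mutual_information_def KL_divergence_def Q_def)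
qed

section \<open>Laws generated by causal kernels\<close>

lemma vec_component [measurable]: "i < p \<Longrightarrow> (\<lambda>z. z i) \<in> borel_measurable (vec_space p)"
  unfolding vec_space_def by measurable

lemma traj_component [measurable]: "t < N \<Longrightarrow> (\<lambda>x. x t) \<in> traj_space p N \<rightarrow>\<^sub>M vec_space p"
  unfolding traj_space_def by measurable

lemma traj_restrict [measurable]:
  "m \<le> N \<Longrightarrow> (\<lambda>x. restrict x {..<m}) \<in> traj_space p N \<rightarrow>\<^sub>M traj_space p m"
  unfolding traj_space_def by (rule measurable_restrict_subset) simp

lemma traj_update [measurable]:
  "(\<lambda>(y, v). y(t := v)) \<in> traj_space p t \<Otimes>\<^sub>M vec_space p \<rightarrow>\<^sub>M traj_space p (Suc t)"
  unfolding traj_space_def lessThan_Suc by (simp add: case_prod_beta' measurable_component_update)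

lemma traj_update_single [measurable]:
  "y \<in> space (traj_space p t) \<Longrightarrow> (\<lambda>v. y(t := v)) \<in> vec_space p \<rightarrow>\<^sub>M traj_space p (Suc t)"
  using measurable_Pair2[OF traj_update] by simp

lemma undefined_traj_space_0: "(\<lambda>_. undefined) \<in> space (traj_space p 0)"
  by (simp add: traj_space_def)

context
  fixes p N :: nat and K :: "nat \<Rightarrow> trajectory \<times> trajectory \<Rightarrow> point measure"
  assumes K: "K \<in> causal_kernels p N"
begin

lemma causal_kernel [measurable]:
  "t < N \<Longrightarrow> K t \<in> traj_space p t \<Otimes>\<^sub>M traj_space p (Suc t) \<rightarrow>\<^sub>M prob_algebra (vec_space p)"
  using K by (auto simp: causal_kernels_def)

lemma causal_step_measurable:
  assumes t: "t < N"
  shows "(\<lambda>(x, y). distr (K t (y, restrict x {..<Suc t})) (traj_space p (Suc t)) (\<lambda>v. y(t := v)))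
    \<in> traj_space p N \<Otimes>\<^sub>M traj_space p t \<rightarrow>\<^sub>M prob_algebra (traj_space p (Suc t))"
proof -
  let ?M = "traj_space p N \<Otimes>\<^sub>M traj_space p t"
  have "(\<lambda>z. restrict (fst z) {..<Suc t}) \<in> ?M \<rightarrow>\<^sub>M traj_space p (Suc t)"
    by (rule measurable_compose[OF measurable_fst traj_restrict]) (use t in simp)
  then have "(\<lambda>z. K t (snd z, restrict (fst z) {..<Suc t})) \<in> ?M \<rightarrow>\<^sub>M prob_algebra (vec_space p)"
    by (intro measurable_compose[OF measurable_Pair[OF measurable_snd] causal_kernel[OF t]])
  moreover have "(\<lambda>w. (snd (fst w))(t := snd w)) \<in> ?M \<Otimes>\<^sub>M vec_space p \<rightarrow>\<^sub>M traj_space p (Suc t)"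
    using measurable_compose[OF measurable_Pair[OF measurable_compose[OF measurable_fst measurable_snd]
        measurable_snd] traj_update] by simp
  ultimately show ?thesis
    unfolding case_prod_beta'
    by (intro measurable_distr_prob_space2[where M = "vec_space p"]) (simp_all add: case_prod_beta')
qed

lemma causal_law_measurable [measurable]:
  "t \<le> N \<Longrightarrow> (\<lambda>x. causal_law p K x t) \<in> traj_space p N \<rightarrow>\<^sub>M prob_algebra (traj_space p t)"
proof (induction t)
  case 0
  show ?case
    by (simp add: space_prob_algebra prob_space_return undefined_traj_space_0)
next
  case (Suc t)
  then show ?case
    unfolding causal_law.simps
    by (intro measurable_bind_prob_space2[where N = "traj_space p t"] causal_step_measurable) auto
qed

lemma
  assumes "t \<le> N" "x \<in> space (traj_space p N)"
  shows prob_space_causal_law: "prob_space (causal_law p K x t)"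
    and sets_causal_law: "sets (causal_law p K x t) = sets (traj_space p t)"
  using measurable_space[OF causal_law_measurable[OF assms(1)] assms(2)]
  by (auto simp: space_prob_algebra)

lemma joint_law_facts:
  assumes P: "P \<in> space (prob_algebra (traj_space p N))"
  shows "f \<in> borel_measurable (traj_space p N \<Otimes>\<^sub>M traj_space p N) \<Longrightarrow>
      (\<integral>\<^sup>+z. f z \<partial>joint_law p N P K) = (\<integral>\<^sup>+x. \<integral>\<^sup>+y. f (x, y) \<partial>causal_law p K x N \<partial>P)"
    and "sets (joint_law p N P K) = sets (traj_space p N \<Otimes>\<^sub>M traj_space p N)"
    and "prob_space (joint_law p N P K)"
    and "distr (joint_law p N P K) (traj_space p N) fst = P"
proof -
  let ?T = "traj_space p N"
  have sets_P: "sets P = sets ?T" and prob_P: "prob_space P" using P by (auto simp: space_prob_algebra)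
  note [measurable_cong] = sets_P
  have space_P: "space P = space ?T" using sets_P by (rule sets_eq_imp_space_eq)
  interpret P: prob_space P by fact
  have ker: "(\<lambda>x. distr (causal_law p K x N) (?T \<Otimes>\<^sub>M ?T) (\<lambda>y. (x, y))) \<in> ?T \<rightarrow>\<^sub>M prob_algebra (?T \<Otimes>\<^sub>M ?T)"
    by (rule measurable_distr_prob_space2[where M = ?T]) simp_all
  then have ker': "(\<lambda>x. distr (causal_law p K x N) (?T \<Otimes>\<^sub>M ?T) (\<lambda>y. (x, y))) \<in> P \<rightarrow>\<^sub>M subprob_algebra (?T \<Otimes>\<^sub>M ?T)"
    by (simp add: measurable_prob_algebraD cong: measurable_cong_sets)
  note cl = sets_causal_law[OF order.refl]
  show "(\<integral>\<^sup>+z. f z \<partial>joint_law p N P K) = (\<integral>\<^sup>+x. \<integral>\<^sup>+y. f (x, y) \<partial>causal_law p K x N \<partial>P)"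
    if f [measurable]: "f \<in> borel_measurable (?T \<Otimes>\<^sub>M ?T)"
    unfolding joint_law_def nn_integral_bind[OF f ker']
    by (intro nn_integral_cong nn_integral_distr) (auto simp: space_P measurable_cong_sets[OF cl refl])
  show "sets (joint_law p N P K) = sets (?T \<Otimes>\<^sub>M ?T)"
    unfolding joint_law_def by (rule sets_bind'[OF P ker])
  show "prob_space (joint_law p N P K)"
    unfolding joint_law_def by (rule prob_space_bind'[OF P ker])
  have "distr (joint_law p N P K) ?T fst
      = P \<bind> (\<lambda>x. distr (distr (causal_law p K x N) (?T \<Otimes>\<^sub>M ?T) (\<lambda>y. (x, y))) ?T fst)"
    unfolding joint_law_def by (rule distr_bind[OF ker' P.not_empty]) simp
  also have "\<dots> = P \<bind> return ?T"
  proof (rule bind_cong[OF refl])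
    fix x assume "x \<in> space P"
    then have x: "x \<in> space ?T" by (simp add: space_P)
    interpret c: prob_space "causal_law p K x N" using prob_space_causal_law[OF order.refl x] .
    have "distr (distr (causal_law p K x N) (?T \<Otimes>\<^sub>M ?T) (\<lambda>y. (x, y))) ?T fst
        = distr (causal_law p K x N) ?T (\<lambda>_. x)"
      using x by (subst distr_distr) (auto simp: measurable_cong_sets[OF cl[OF x] refl] comp_def)
    also have "\<dots> = return ?T x"
      using x by (rule c.distr_const)
    finally show "distr (distr (causal_law p K x N) (?T \<Otimes>\<^sub>M ?T) (\<lambda>y. (x, y))) ?T fst = return ?T x" .
  qed
  also have "\<dots> = P" by (rule bind_return''[OF sets_P])
  finally show "distr (joint_law p N P K) ?T fst = P" .
qed

text \<open>
Together with the next lemma this is causality: the law of the reconstruction up to time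
\<open>t - 1\<close> is the same for all source paths that agree up to that time.
\<close>

lemma causal_law_cong:
  "restrict x {..<t} = restrict x' {..<t} \<Longrightarrow> causal_law p K x t = causal_law p K x' t"
proof (induction t)
  case (Suc t)
  have "restrict x {..<t} = restrict (restrict x {..<Suc t}) {..<t}"
    by (auto simp: restrict_def fun_eq_iff)
  also have "\<dots> = restrict x' {..<t}"
    unfolding Suc.prems by (auto simp: restrict_def fun_eq_iff)
  finally have "causal_law p K x t = causal_law p K x' t" by (rule Suc.IH)
  then show ?case unfolding causal_law.simps Suc.prems by simp
qed simp

lemma causal_law_marginal:
  assumes x: "x \<in> space (traj_space p N)" and "t \<le> m" "m \<le> N"
  shows "distr (causal_law p K x m) (traj_space p t) (\<lambda>y. restrict y {..<t}) = causal_law p K x t"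
  using assms(2,3)
proof (induction m rule: dec_induct)
  case base
  note sets = sets_causal_law[OF base x]
  have "distr (causal_law p K x t) (traj_space p t) (\<lambda>y. restrict y {..<t})
      = distr (causal_law p K x t) (causal_law p K x t) (\<lambda>y. y)"
    using sets_eq_imp_space_eq[OF sets]
    by (intro distr_cong) (auto simp: sets traj_space_def space_PiM PiE_iff extensional_restrict)
  also have "\<dots> = causal_law p K x t" by (rule distr_id)
  finally show ?case .
next
  case (step m)
  then have m: "m < N" "m \<le> N" by auto
  note cl = sets_causal_law[OF m(2) x]
  note cl_space = sets_eq_imp_space_eq[OF cl]
  interpret c: prob_space "causal_law p K x m" using prob_space_causal_law[OF m(2) x] .
  let ?k = "\<lambda>y. K m (y, restrict x {..<Suc m})"
  have rx: "restrict x {..<Suc m} \<in> space (traj_space p (Suc m))"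
    using measurable_space[OF traj_restrict x, of "Suc m"] m by simp
  have k: "prob_space (?k y)" "sets (?k y) = sets (vec_space p)" if "y \<in> space (traj_space p m)" for y
    using measurable_space[OF causal_kernel[OF m(1)], of "(y, restrict x {..<Suc m})"] that rx
    by (auto simp: space_prob_algebra space_pair_measure)
  have ker: "(\<lambda>y. distr (?k y) (traj_space p (Suc m)) (\<lambda>v. y(m := v)))
      \<in> causal_law p K x m \<rightarrow>\<^sub>M subprob_algebra (traj_space p (Suc m))"
    using measurable_Pair2[OF causal_step_measurable[OF m(1)] x]
    by (simp add: measurable_prob_algebraD measurable_cong_sets[OF cl refl])
  have "distr (causal_law p K x (Suc m)) (traj_space p t) (\<lambda>y. restrict y {..<t})
      = causal_law p K x m \<bind> (\<lambda>y. distr (distr (?k y) (traj_space p (Suc m)) (\<lambda>v. y(m := v)))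
          (traj_space p t) (\<lambda>y. restrict y {..<t}))"
    unfolding causal_law.simps using step.hyps by (intro distr_bind[OF ker c.not_empty]) simp
  also have "\<dots> = causal_law p K x m \<bind> (\<lambda>y. return (traj_space p t) (restrict y {..<t}))"
  proof (rule bind_cong[OF refl])
    fix y assume "y \<in> space (causal_law p K x m)"
    then have y: "y \<in> space (traj_space p m)" by (simp add: cl_space)
    interpret k: prob_space "?k y" using k(1)[OF y] .
    have ry: "restrict y {..<t} \<in> space (traj_space p t)"
      using measurable_space[OF traj_restrict y, of t] step.hyps by simp
    have "distr (distr (?k y) (traj_space p (Suc m)) (\<lambda>v. y(m := v))) (traj_space p t) (\<lambda>y. restrict y {..<t})
        = distr (?k y) (traj_space p t) (\<lambda>_. restrict y {..<t})"
    proof (subst distr_distr)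
      show "(\<lambda>y. restrict y {..<t}) \<in> traj_space p (Suc m) \<rightarrow>\<^sub>M traj_space p t"
        using step.hyps by (intro traj_restrict) simp
      show "(\<lambda>v. y(m := v)) \<in> ?k y \<rightarrow>\<^sub>M traj_space p (Suc m)"
        unfolding measurable_cong_sets[OF k(2)[OF y] refl] by (rule traj_update_single[OF y])
      have "restrict (y(m := v)) {..<t} = restrict y {..<t}" for v
        using step.hyps by (auto simp: restrict_def fun_eq_iff)
      then show "distr (?k y) (traj_space p t) ((\<lambda>y. restrict y {..<t}) \<circ> (\<lambda>v. y(m := v)))
          = distr (?k y) (traj_space p t) (\<lambda>_. restrict y {..<t})"
        by (simp only: comp_def)
    qed
    also have "\<dots> = return (traj_space p t) (restrict y {..<t})"
      using ry by (rule k.distr_const)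
    finally show "distr (distr (?k y) (traj_space p (Suc m)) (\<lambda>v. y(m := v))) (traj_space p t)
        (\<lambda>y. restrict y {..<t}) = return (traj_space p t) (restrict y {..<t})" .
  qed
  also have "\<dots> = distr (causal_law p K x m) (traj_space p t) (\<lambda>y. restrict y {..<t})"
    using step.hyps
    by (intro bind_return_distr'[OF c.not_empty]) (simp add: measurable_cong_sets[OF cl refl])
  also have "\<dots> = causal_law p K x t" by (rule step.IH[OF m(2)])
  finally show ?case .
qed

end

lemma nn_integral_causal_law_Suc:
  assumes K: "K \<in> causal_kernels p N" and t: "t < N" and x: "x \<in> space (traj_space p N)"
    and g: "g \<in> borel_measurable (traj_space p (Suc t))"
  shows "(\<integral>\<^sup>+y. g y \<partial>causal_law p K x (Suc t))
    = (\<integral>\<^sup>+y. \<integral>\<^sup>+v. g (y(t := v)) \<partial>K t (y, restrict x {..<Suc t}) \<partial>causal_law p K x t)"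
proof -
  have t': "t \<le> N" using t by simp
  note cl = sets_causal_law[OF K t' x]
  have ker: "(\<lambda>y. distr (K t (y, restrict x {..<Suc t})) (traj_space p (Suc t)) (\<lambda>v. y(t := v)))
      \<in> causal_law p K x t \<rightarrow>\<^sub>M subprob_algebra (traj_space p (Suc t))"
    using measurable_Pair2[OF causal_step_measurable[OF K t] x]
    by (simp add: measurable_prob_algebraD measurable_cong_sets[OF cl refl])
  have "(\<integral>\<^sup>+v. g v \<partial>distr (K t (y, restrict x {..<Suc t})) (traj_space p (Suc t)) (\<lambda>v. y(t := v)))
      = (\<integral>\<^sup>+v. g (y(t := v)) \<partial>K t (y, restrict x {..<Suc t}))"
    if "y \<in> space (causal_law p K x t)" for y
  proof (subst nn_integral_distr)
    have y: "y \<in> space (traj_space p t)" using that sets_eq_imp_space_eq[OF cl] by simp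
    have "restrict x {..<Suc t} \<in> space (traj_space p (Suc t))"
      using measurable_space[OF traj_restrict x, of "Suc t"] t by simp
    then have k: "sets (K t (y, restrict x {..<Suc t})) = sets (vec_space p)"
      using measurable_space[OF causal_kernel[OF K t], of "(y, restrict x {..<Suc t})"] y
      by (auto simp: space_prob_algebra space_pair_measure)
    show "(\<lambda>v. y(t := v)) \<in> K t (y, restrict x {..<Suc t}) \<rightarrow>\<^sub>M traj_space p (Suc t)"
      unfolding measurable_cong_sets[OF k refl] by (rule traj_update_single[OF y])
  qed (simp_all add: g)
  then show ?thesis
    unfolding causal_law.simps nn_integral_bind[OF g ker] by (intro nn_integral_cong) simp
qed

section \<open>A source with nilpotent state matrix\<close>

definition shift_mat :: "real mat" where
  "shift_mat = mat 2 2 (\<lambda>(i, j). if i = 0 \<and> j = 1 then 1 else 0)"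

definition noise_cov :: "real mat" where
  "noise_cov = mat_diag 2 (\<lambda>i. real (Suc i))"

definition noise :: "point measure" where
  "noise = PiM {..<2} (\<lambda>i. centered_normal (real (Suc i)))"

definition noises :: "nat \<Rightarrow> trajectory measure" where
  "noises N = PiM {..<N} (\<lambda>_. noise)"

text \<open>
The closed form of the process: the square of the state matrix is zero, so the state remembers
only the current and the previous noise.
\<close>

definition state_path :: "nat \<Rightarrow> trajectory \<Rightarrow> trajectory" where
  "state_path N \<omega> = (\<lambda>t\<in>{..<N}. \<lambda>i\<in>{..<2}.
     if i = 0 then (if t = 0 then 0 else \<omega> (t - 1) 1) + \<omega> t 0 else \<omega> t i)"

lemma lessThan_2: "{..<2::nat} = {0, 1}" by auto

lemma product_prob_space_normals: "product_prob_space (\<lambda>i. centered_normal (real (Suc i)))"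
  by (auto simp: product_prob_space_def product_prob_space_axioms_def product_sigma_finite_def
      intro!: prob_space_imp_sigma_finite prob_space_centered_normal)

interpretation normals: product_prob_space "\<lambda>i. centered_normal (real (Suc i))" "{..<2}"
  by (rule product_prob_space_normals)

lemma prob_space_noise: "prob_space noise"
  unfolding noise_def by (intro prob_space_PiM prob_space_centered_normal) simp

interpretation noise_seq: product_prob_space "\<lambda>_::nat. noise" UNIV
  by (auto simp: product_prob_space_def product_prob_space_axioms_def product_sigma_finite_def
      intro!: prob_space_imp_sigma_finite prob_space_noise)

lemma sets_noise [measurable_cong]: "sets noise = sets (vec_space 2)"
  unfolding noise_def vec_space_def by (intro sets_PiM_cong) auto

lemma sets_noises [measurable_cong]: "sets (noises N) = sets (traj_space 2 N)"
  unfolding noises_def traj_space_def by (intro sets_PiM_cong) (auto simp: sets_noise)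

lemma prob_space_noises: "prob_space (noises N)"
  unfolding noises_def by (intro prob_space_PiM prob_space_noise)

lemma noises_component [measurable]:
  "t < N \<Longrightarrow> i < 2 \<Longrightarrow> (\<lambda>\<omega>. \<omega> t i) \<in> borel_measurable (traj_space 2 N)"
  by (rule measurable_compose[OF traj_component vec_component])

lemma gaussian_noise_cov: "gaussian 2 noise_cov = noise"
  unfolding noise_cov_def noise_def by (rule gaussian_mat_diag) simp

lemma state_path_simps:
  "t < N \<Longrightarrow> state_path N \<omega> t (Suc 0) = \<omega> t (Suc 0)"
  "Suc t < N \<Longrightarrow> state_path N \<omega> (Suc t) 0 = \<omega> t (Suc 0) + \<omega> (Suc t) 0"
  "0 < N \<Longrightarrow> state_path N \<omega> 0 0 = \<omega> 0 0"
  by (simp_all add: state_path_def)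

lemma state_path_measurable [measurable]: "state_path N \<in> traj_space 2 N \<rightarrow>\<^sub>M traj_space 2 N"
proof -
  have "(\<lambda>\<omega>. if i = 0 then (if t = 0 then 0 else \<omega> (t - 1) 1) + \<omega> t 0 else \<omega> t i)
      \<in> borel_measurable (traj_space 2 N)" if "t < N" "i < 2" for t i
  proof (cases t)
    case 0
    then show ?thesis using that by (cases "i = 0") auto
  next
    case (Suc m)
    then show ?thesis using that by (cases "i = 0") auto
  qed
  then have "(\<lambda>\<omega>. \<lambda>t\<in>{..<N}. \<lambda>i\<in>{..<2}.
     if i = 0 then (if t = 0 then 0 else \<omega> (t - 1) 1) + \<omega> t 0 else \<omega> t i)
     \<in> traj_space 2 N \<rightarrow>\<^sub>M PiM {..<N} (\<lambda>_. PiM {..<2} (\<lambda>_. borel))"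
    by (intro measurable_restrict) auto
  then show ?thesis unfolding state_path_def[abs_def] by (simp add: traj_space_def vec_space_def)
qed

lemma gm_process_shift:
  assumes "\<omega> 0 \<in> extensional {..<2}"
  shows "gm_process 2 shift_mat t \<omega> = (\<lambda>i\<in>{..<2}.
     if i = 0 then (if t = 0 then 0 else \<omega> (t - 1) 1) + \<omega> t 0 else \<omega> t i)"
proof (induction t)
  case 0
  then show ?case using assms by (auto simp: fun_eq_iff extensional_def)
next
  case (Suc t)
  have "vec_index (shift_mat *\<^sub>v vec 2 x) i = (if i = 0 then x 1 else 0)" if "i < 2" for x i
    using that by (auto simp: shift_mat_def scalar_prod_def numeral_2_eq_2)
  then show ?case using Suc by (auto simp: fun_eq_iff)
qed

abbreviation source :: "nat \<Rightarrow> trajectory measure" where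
  "source \<equiv> gm_law 2 shift_mat noise_cov noise_cov"

lemma gm_law_shift:
  "source N = distr (noises N) (traj_space 2 N) (state_path N)"
proof -
  have drv: "gm_driving 2 noise_cov noise_cov = PiM UNIV (\<lambda>_. noise)"
    by (simp add: gm_driving_def gaussian_noise_cov)
  have restr: "distr (PiM UNIV (\<lambda>_. noise)) (PiM {..<N} (\<lambda>_. noise)) (\<lambda>x. restrict x {..<N}) = noises N"
    unfolding noises_def by (rule noise_seq.distr_PiM_restrict_finite) auto
  have meas: "(\<lambda>x. restrict x {..<N}) \<in> PiM UNIV (\<lambda>_. noise) \<rightarrow>\<^sub>M PiM {..<N} (\<lambda>_. noise)"
    by (rule measurable_restrict_subset) simp
  have sets_N: "sets (PiM {..<N} (\<lambda>_. noise)) = sets (traj_space 2 N)"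
    using sets_noises by (simp add: noises_def)
  have "(\<lambda>t\<in>{..<N}. gm_process 2 shift_mat t \<omega>) = state_path N (restrict \<omega> {..<N})"
    if "\<omega> \<in> space (PiM UNIV (\<lambda>_. noise))" for \<omega>
  proof -
    have "\<omega> 0 \<in> space noise" using that by (auto simp: space_PiM)
    then have "\<omega> 0 \<in> extensional {..<2}" by (simp add: noise_def space_PiM PiE_iff)
    then show ?thesis by (auto simp: gm_process_shift state_path_def fun_eq_iff)
  qed
  then have "source N
      = distr (PiM UNIV (\<lambda>_. noise)) (traj_space 2 N) (state_path N \<circ> (\<lambda>x. restrict x {..<N}))"
    unfolding gm_law_def drv by (intro distr_cong) auto
  also have "\<dots> = distr (noises N) (traj_space 2 N) (state_path N)"
    unfolding restr[symmetric]
    by (rule distr_distr[symmetric, OF _ meas]) (simp add: measurable_cong_sets[OF sets_N refl])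
  finally show ?thesis .
qed

lemma
  shows prob_space_gm_law: "prob_space (source N)"
    and gm_law_in_prob_algebra:
      "source N \<in> space (prob_algebra (traj_space 2 N))"
    and sets_gm_law [measurable_cong]:
      "sets (source N) = sets (traj_space 2 N)"
    and nn_integral_gm_law: "f \<in> borel_measurable (traj_space 2 N) \<Longrightarrow>
      (\<integral>\<^sup>+x. f x \<partial>source N) = (\<integral>\<^sup>+\<omega>. f (state_path N \<omega>) \<partial>noises N)"
proof -
  show 1: "prob_space (source N)"
    unfolding gm_law_shift by (rule prob_space.prob_space_distr[OF prob_space_noises]) measurable
  show 2: "sets (source N) = sets (traj_space 2 N)"
    by (simp add: gm_law_shift)
  show "source N \<in> space (prob_algebra (traj_space 2 N))"
    using 1 2 by (simp add: space_prob_algebra)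
  assume f: "f \<in> borel_measurable (traj_space 2 N)"
  show "(\<integral>\<^sup>+x. f x \<partial>source N) = (\<integral>\<^sup>+\<omega>. f (state_path N \<omega>) \<partial>noises N)"
    unfolding gm_law_shift by (rule nn_integral_distr) (use f in measurable)
qed

lemma nn_integral_noises_component:
  assumes "t < N" "i < 2" and [measurable]: "g \<in> borel_measurable borel"
  shows "(\<integral>\<^sup>+\<omega>. g (\<omega> t i) \<partial>noises N) = (\<integral>\<^sup>+s. g s \<partial>centered_normal (real (Suc i)))"
proof -
  have "(\<integral>\<^sup>+\<omega>. g (\<omega> t i) \<partial>noises N) = (\<integral>\<^sup>+z. g (z i) \<partial>distr (noises N) noise (\<lambda>\<omega>. \<omega> t))"
    using assms by (intro nn_integral_distr[symmetric]) (auto simp: noises_def measurable_cong_sets[OF sets_noise refl])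
  also have "distr (noises N) noise (\<lambda>\<omega>. \<omega> t) = noise"
    unfolding noises_def by (rule distr_PiM_component) (use assms prob_space_noise in auto)
  also have "(\<integral>\<^sup>+z. g (z i) \<partial>noise) = (\<integral>\<^sup>+s. g s \<partial>distr noise (centered_normal (real (Suc i))) (\<lambda>z. z i))"
  proof (rule nn_integral_distr[symmetric])
    show "(\<lambda>z. z i) \<in> noise \<rightarrow>\<^sub>M centered_normal (real (Suc i))"
      unfolding noise_def by (rule measurable_component_singleton) (use assms in simp)
  qed simp
  also have "distr noise (centered_normal (real (Suc i))) (\<lambda>z. z i) = centered_normal (real (Suc i))"
    unfolding noise_def by (rule distr_PiM_component) (use assms prob_space_centered_normal in auto)
  finally show ?thesis .
qed

lemma nn_integral_noises_square:
  assumes "t < N" "i < 2"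
  shows "(\<integral>\<^sup>+\<omega>. ennreal ((\<omega> t i)\<^sup>2) \<partial>noises N) = ennreal (real (Suc i))"
  using nn_integral_noises_component[OF assms, of "\<lambda>s. ennreal (s\<^sup>2)"]
    nn_integral_centered_normal_square[of "real (Suc i)" 0] by simp

lemma nn_integral_noises_prod:
  assumes h [measurable]: "\<And>t i. h t i \<in> borel_measurable borel"
    and h1: "\<And>t i. t < N \<Longrightarrow> i < 2 \<Longrightarrow> (\<integral>\<^sup>+s. h t i s \<partial>centered_normal (real (Suc i))) = 1"
  shows "(\<integral>\<^sup>+\<omega>. (\<Prod>t<N. \<Prod>i<2. h t i (\<omega> t i)) \<partial>noises N) = 1"
proof -
  have m: "(\<lambda>z. \<Prod>i<2. h t i (z i)) \<in> borel_measurable noise" for t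
  proof (rule borel_measurable_prod_ennreal)
    fix i :: nat assume "i \<in> {..<2}"
    then show "(\<lambda>z. h t i (z i)) \<in> borel_measurable noise"
      by (intro measurable_compose[OF _ h]) (simp add: measurable_cong_sets[OF sets_noise refl])
  qed
  have "(\<integral>\<^sup>+\<omega>. (\<Prod>t<N. \<Prod>i<2. h t i (\<omega> t i)) \<partial>noises N)
      = (\<Prod>t<N. \<integral>\<^sup>+z. (\<Prod>i<2. h t i (z i)) \<partial>noise)"
    unfolding noises_def by (rule noise_seq.product_nn_integral_prod) (simp_all add: m)
  also have "\<dots> = (\<Prod>t<N. \<Prod>i<2. \<integral>\<^sup>+s. h t i s \<partial>centered_normal (real (Suc i)))"
    unfolding noise_def by (intro prod.cong refl normals.product_nn_integral_prod) simp_all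
  also have "\<dots> = 1" using h1 by simp
  finally show ?thesis .
qed

text \<open>
Reversing one scalar innovation preserves the law of the noise.  Orthogonality of an innovation
to a quantity that ignores it is used in the form of invariance under this symmetry, which needs
no integrability and works for extended nonnegative integrals.
\<close>

definition flip_innovation :: "nat \<Rightarrow> trajectory \<Rightarrow> trajectory" where
  "flip_innovation t w = w(t := (w t)(0 := - w t 0))"

lemma
  assumes t: "t < N"
  shows flip_innovation_measurable: "flip_innovation t \<in> noises N \<rightarrow>\<^sub>M noises N"
    and distr_flip_innovation: "distr (noises N) (noises N) (flip_innovation t) = noises N"
proof -
  let ?\<phi> = "\<lambda>z::point. z(0 := - z 0)"
  have \<phi>: "?\<phi> \<in> noise \<rightarrow>\<^sub>M noise" "distr noise noise ?\<phi> = noise"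
    unfolding noise_def
    using distr_PiM_update[OF product_prob_space_normals, of "{..<2}" 0 uminus]
      distr_uminus_centered_normal by auto
  show "flip_innovation t \<in> noises N \<rightarrow>\<^sub>M noises N" "distr (noises N) (noises N) (flip_innovation t) = noises N"
    unfolding noises_def flip_innovation_def[abs_def]
    using distr_PiM_update[OF noise_seq.product_prob_space_axioms, of "{..<N}" t ?\<phi>] \<phi> t by auto
qed

text \<open>
The symmetry hypothesis replaces the vanishing of the cross term; the claim is then the
parallelogram law.
\<close>

lemma nn_integral_square_add:
  fixes a w :: "'a \<Rightarrow> real"
  assumes [measurable]: "a \<in> borel_measurable M" "w \<in> borel_measurable M"
    and sym: "(\<integral>\<^sup>+z. ennreal ((a z - w z)\<^sup>2) \<partial>M) = (\<integral>\<^sup>+z. ennreal ((a z + w z)\<^sup>2) \<partial>M)"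
  shows "(\<integral>\<^sup>+z. ennreal ((a z + w z)\<^sup>2) \<partial>M)
    = (\<integral>\<^sup>+z. ennreal ((a z)\<^sup>2) \<partial>M) + (\<integral>\<^sup>+z. ennreal ((w z)\<^sup>2) \<partial>M)"
proof -
  let ?X = "\<integral>\<^sup>+z. ennreal ((a z + w z)\<^sup>2) \<partial>M"
  have "2 * ?X = (\<integral>\<^sup>+z. ennreal ((a z + w z)\<^sup>2) \<partial>M) + (\<integral>\<^sup>+z. ennreal ((a z - w z)\<^sup>2) \<partial>M)"
    unfolding sym by (simp add: mult_2)
  also have "\<dots> = (\<integral>\<^sup>+z. ennreal ((a z + w z)\<^sup>2) + ennreal ((a z - w z)\<^sup>2) \<partial>M)"
    by (rule nn_integral_add[symmetric]) measurable
  also have "\<dots> = (\<integral>\<^sup>+z. 2 * (ennreal ((a z)\<^sup>2) + ennreal ((w z)\<^sup>2)) \<partial>M)"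
  proof (rule nn_integral_cong)
    fix z
    have "ennreal ((a z + w z)\<^sup>2) + ennreal ((a z - w z)\<^sup>2) = ennreal ((a z + w z)\<^sup>2 + (a z - w z)\<^sup>2)"
      by (rule ennreal_plus[symmetric]) simp_all
    also have "(a z + w z)\<^sup>2 + (a z - w z)\<^sup>2 = 2 * ((a z)\<^sup>2 + (w z)\<^sup>2)"
      by (simp add: power2_eq_square algebra_simps)
    finally have "ennreal ((a z + w z)\<^sup>2) + ennreal ((a z - w z)\<^sup>2) = ennreal (2 * ((a z)\<^sup>2 + (w z)\<^sup>2))" .
    then show "ennreal ((a z + w z)\<^sup>2) + ennreal ((a z - w z)\<^sup>2) = 2 * (ennreal ((a z)\<^sup>2) + ennreal ((w z)\<^sup>2))"
      by (simp add: ennreal_mult)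
  qed
  also have "\<dots> = 2 * ((\<integral>\<^sup>+z. ennreal ((a z)\<^sup>2) \<partial>M) + (\<integral>\<^sup>+z. ennreal ((w z)\<^sup>2) \<partial>M))"
    by (subst nn_integral_cmult) (simp_all add: nn_integral_add)
  finally show ?thesis by (subst (asm) ennreal_mult_cancel_left) simp
qed

section \<open>Lower bound on the rate of every causal reconstruction\<close>

text \<open>
The innovation \<open>x\<^sub>(\<^sub>t\<^sub>+\<^sub>1\<^sub>)\<^sub>,\<^sub>0 - x\<^sub>t\<^sub>,\<^sub>1\<close> is the noise component \<open>w\<^sub>(\<^sub>t\<^sub>+\<^sub>1\<^sub>)\<close>.  Given the source, the
law of \<open>y\<^sub>t\<close> depends on the source up to time t only, hence not on \<open>w\<^sub>(\<^sub>t\<^sub>+\<^sub>1\<^sub>)\<close>, whose sign can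
therefore be changed.  This is the only place where causality enters the converse.
\<close>

lemma nn_integral_innovation_flip:
  assumes K: "K \<in> causal_kernels 2 N" and t: "Suc t < N"
  shows "(\<integral>\<^sup>+z. ennreal (((fst z t 1 - snd z t 1) - (fst z (Suc t) 0 - fst z t 1))\<^sup>2)
      \<partial>joint_law 2 N (source N) K)
    = (\<integral>\<^sup>+z. ennreal (((fst z t 1 - snd z t 1) + (fst z (Suc t) 0 - fst z t 1))\<^sup>2)
      \<partial>joint_law 2 N (source N) K)"
proof -
  define G where "G \<sigma> x y = ennreal (((x t 1 - y t 1) + \<sigma> * (x (Suc t) 0 - x t 1))\<^sup>2)"
    for \<sigma> :: real and x y :: trajectory
  define F where "F \<sigma> x = (\<integral>\<^sup>+y. G \<sigma> x y \<partial>causal_law 2 K x N)" for \<sigma> x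
  have t': "t < N" "Suc t \<le> N" using t by auto
  have G_meas [measurable]: "(\<lambda>(x, y). G \<sigma> x y) \<in> borel_measurable (traj_space 2 N \<Otimes>\<^sub>M traj_space 2 N)" for \<sigma>
    unfolding G_def using t t' by measurable
  have F_meas [measurable]: "F \<sigma> \<in> borel_measurable (traj_space 2 N)" for \<sigma>
    unfolding F_def
    by (rule nn_integral_measurable_subprob_algebra2[where N = "traj_space 2 N"])
      (use G_meas[of \<sigma>] causal_law_measurable[OF K order.refl] in \<open>auto intro: measurable_prob_algebraD\<close>)
  have J: "(\<integral>\<^sup>+z. G \<sigma> (fst z) (snd z) \<partial>joint_law 2 N (source N) K)
      = (\<integral>\<^sup>+\<omega>. F \<sigma> (state_path N \<omega>) \<partial>noises N)" for \<sigma>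
    using joint_law_facts(1)[OF K gm_law_in_prob_algebra, of "\<lambda>z. G \<sigma> (fst z) (snd z)"]
      G_meas[of \<sigma>] nn_integral_gm_law[OF F_meas, of \<sigma>]
    by (simp add: F_def case_prod_beta')
  have space: "state_path N \<omega> \<in> space (traj_space 2 N)" if "\<omega> \<in> space (noises N)" for \<omega>
    using that measurable_space[OF state_path_measurable] sets_eq_imp_space_eq[OF sets_noises] by auto
  \<comment> \<open>The integrand depends on the reconstruction up to time t only, so the law up to time t suffices.\<close>
  have F_eq: "F \<sigma> x = (\<integral>\<^sup>+y. ennreal (((x t 1 - y t 1) + \<sigma> * (x (Suc t) 0 - x t 1))\<^sup>2)
      \<partial>causal_law 2 K x (Suc t))" if x: "x \<in> space (traj_space 2 N)" for \<sigma> x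
  proof -
    have r: "(\<lambda>y. restrict y {..<Suc t}) \<in> causal_law 2 K x N \<rightarrow>\<^sub>M traj_space 2 (Suc t)"
      unfolding measurable_cong_sets[OF sets_causal_law[OF K order.refl x] refl]
      using t'(2) by (rule traj_restrict)
    have "(\<integral>\<^sup>+y. G \<sigma> x y \<partial>causal_law 2 K x (Suc t))
        = (\<integral>\<^sup>+y. G \<sigma> x (restrict y {..<Suc t}) \<partial>causal_law 2 K x N)"
      unfolding causal_law_marginal[OF K x t'(2) order.refl, symmetric]
      by (rule nn_integral_distr[OF r]) (simp add: G_def)
    also have "\<dots> = F \<sigma> x" by (simp add: F_def G_def)
    finally show ?thesis by (simp add: G_def)
  qed
  have F_flip: "F \<sigma> (state_path N (flip_innovation (Suc t) \<omega>)) = F (- \<sigma>) (state_path N \<omega>)" if "\<omega> \<in> space (noises N)" for \<sigma> \<omega>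
  proof -
    have \<omega>': "flip_innovation (Suc t) \<omega> \<in> space (noises N)"
      using measurable_space[OF flip_innovation_measurable[OF t] that] .
    have "restrict (state_path N (flip_innovation (Suc t) \<omega>)) {..<Suc t} = restrict (state_path N \<omega>) {..<Suc t}"
      by (auto simp: state_path_def flip_innovation_def fun_eq_iff)
    from causal_law_cong[OF K this] show ?thesis
      using t t' by (simp add: F_eq[OF space] that \<omega>' state_path_simps del: causal_law.simps) (simp add: flip_innovation_def)
  qed
  have "(\<integral>\<^sup>+\<omega>. F \<sigma> (state_path N \<omega>) \<partial>noises N) = (\<integral>\<^sup>+\<omega>. F (- \<sigma>) (state_path N \<omega>) \<partial>noises N)" for \<sigma>
  proof -
    have "(\<integral>\<^sup>+\<omega>. F \<sigma> (state_path N \<omega>) \<partial>noises N) = (\<integral>\<^sup>+\<omega>. F \<sigma> (state_path N \<omega>) \<partial>distr (noises N) (noises N) (flip_innovation (Suc t)))"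
      by (simp add: distr_flip_innovation[OF t])
    also have "\<dots> = (\<integral>\<^sup>+\<omega>. F \<sigma> (state_path N (flip_innovation (Suc t) \<omega>)) \<partial>noises N)"
      by (rule nn_integral_distr[OF flip_innovation_measurable[OF t]]) measurable
    also have "\<dots> = (\<integral>\<^sup>+\<omega>. F (- \<sigma>) (state_path N \<omega>) \<partial>noises N)"
      by (rule nn_integral_cong) (rule F_flip)
    finally show ?thesis .
  qed
  from this[of 1] have "(\<integral>\<^sup>+z. G (- 1) (fst z) (snd z) \<partial>joint_law 2 N (source N) K)
      = (\<integral>\<^sup>+z. G 1 (fst z) (snd z) \<partial>joint_law 2 N (source N) K)"
    by (simp add: J)
  then show ?thesis by (simp add: G_def)
qed

lemma nn_integral_joint_source:
  assumes K: "K \<in> causal_kernels 2 N" and g: "g \<in> borel_measurable (traj_space 2 N)"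
  shows "(\<integral>\<^sup>+z. g (fst z) \<partial>joint_law 2 N (source N) K) = (\<integral>\<^sup>+\<omega>. g (state_path N \<omega>) \<partial>noises N)"
proof -
  note joint = joint_law_facts[OF K gm_law_in_prob_algebra]
  have "fst \<in> joint_law 2 N (source N) K \<rightarrow>\<^sub>M traj_space 2 N"
    unfolding measurable_cong_sets[OF joint(2) refl] by (rule measurable_fst)
  then have "(\<integral>\<^sup>+z. g (fst z) \<partial>joint_law 2 N (source N) K)
      = (\<integral>\<^sup>+x. g x \<partial>distr (joint_law 2 N (source N) K) (traj_space 2 N) fst)"
    by (intro nn_integral_distr[symmetric]) (use g in simp_all)
  also have "\<dots> = (\<integral>\<^sup>+\<omega>. g (state_path N \<omega>) \<partial>noises N)"
    unfolding joint(4) by (rule nn_integral_gm_law[OF g])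
  finally show ?thesis .
qed

lemma has_bochner_integral_nn_real:
  assumes "f \<in> borel_measurable M" "\<And>z. 0 \<le> f z" "(\<integral>\<^sup>+z. ennreal (f z) \<partial>M) = ennreal r" "0 \<le> r"
  shows "has_bochner_integral M f r"
  by (rule has_bochner_integral_nn_integral) (use assms in auto)

text \<open>
The distortions at the two ends, of the first coordinate at time 0 and of the second at time
\<open>n\<close>, are not paired with anything; this boundary effect is the constant 3/4, which disappears
after division by \<open>n + 1\<close>.
\<close>

lemma converse_bound:
  assumes b: "1 < b" and K: "K \<in> causal_kernels 2 (Suc n)"
    and D: "\<And>t. t \<le> n \<Longrightarrow> mean_sq_error 2 t (joint_law 2 (Suc n) (source (Suc n)) K) \<le> ennreal 3"
  shows "ereal ((real n * ln 2 / 2 - 3 / 4) / ln b)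
    \<le> mutual_info b (traj_space 2 (Suc n)) (traj_space 2 (Suc n)) (joint_law 2 (Suc n) (source (Suc n)) K)"
proof -
  define N where "N = Suc n"
  define T where "T = traj_space 2 N"
  define J where "J = joint_law 2 N (source N) K"
  have K: "K \<in> causal_kernels 2 N" using K by (simp add: N_def)
  note joint = joint_law_facts[OF K gm_law_in_prob_algebra, folded J_def T_def]
  have sets_J [measurable_cong]: "sets J = sets (T \<Otimes>\<^sub>M T)" by (rule joint(2))
  have prob_J: "prob_space J" by (rule joint(3))
  have fst_J: "distr J T fst = source N" by (rule joint(4))
  interpret J: prob_space J by fact
  have comp [measurable]: "(\<lambda>x. x t i) \<in> borel_measurable T" if "t < N" "i < 2" for t i
    unfolding T_def using that by measurable
  have X [measurable]: "(\<lambda>z. fst z t i) \<in> borel_measurable J"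
    and Y [measurable]: "(\<lambda>z. snd z t i) \<in> borel_measurable J" if "t < N" "i < 2" for t i
    using that by measurable
  note nn_source = nn_integral_joint_source[OF K, folded J_def T_def]
  have u2: "has_bochner_integral J (\<lambda>z. (fst z t 1)\<^sup>2) 2" if "t < N" for t
  proof (rule has_bochner_integral_nn_real)
    show "(\<integral>\<^sup>+z. ennreal ((fst z t 1)\<^sup>2) \<partial>J) = ennreal 2"
      using that nn_source[of "\<lambda>x. ennreal ((x t 1)\<^sup>2)"] nn_integral_noises_square[of t N 1]
      by (simp add: state_path_simps)
  qed (use that in auto)
  have w2_nn: "(\<integral>\<^sup>+z. ennreal ((fst z (Suc t) 0 - fst z t 1)\<^sup>2) \<partial>J) = ennreal 1" if "Suc t < N" for t
    using that nn_source[of "\<lambda>x. ennreal ((x (Suc t) 0 - x t 1)\<^sup>2)"] nn_integral_noises_square[of "Suc t" N 0]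
    by (simp add: state_path_simps)
  have w2: "has_bochner_integral J (\<lambda>z. (fst z (Suc t) 0 - fst z t 1)\<^sup>2) 1" if "Suc t < N" for t
    by (rule has_bochner_integral_nn_real) (use that w2_nn[OF that] in auto)
  define e where "e t i = (\<integral>z. (fst z t i - snd z t i)\<^sup>2 \<partial>J)" for t i
  have sum_nn: "(\<integral>\<^sup>+z. ennreal (\<Sum>i<2. (fst z t i - snd z t i)\<^sup>2) \<partial>J) \<le> ennreal 3" if "t < N" for t
    using D[of t] that by (simp add: mean_sq_error_def J_def N_def case_prod_beta')
  have sum_int: "integrable J (\<lambda>z. \<Sum>i<2. (fst z t i - snd z t i)\<^sup>2)" if "t < N" for t
    using sum_nn[OF that] that
    by (intro integrableI_nonneg) (auto simp: sum_nonneg intro: order.strict_trans1)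
  have e_int: "integrable J (\<lambda>z. (fst z t i - snd z t i)\<^sup>2)" if "t < N" "i < 2" for t i
    by (rule Bochner_Integration.integrable_bound[OF sum_int[OF that(1)]])
      (use that in \<open>auto simp: sum_nonneg intro!: AE_I2 member_le_sum\<close>)
  have e_bh: "has_bochner_integral J (\<lambda>z. (fst z t i - snd z t i)\<^sup>2) (e t i)" if "t < N" "i < 2" for t i
    using e_int[OF that] by (simp add: has_bochner_integral_iff e_def)
  have e_le: "e t 0 + e t 1 \<le> 3" if "t < N" for t
  proof -
    have "e t 0 + e t 1 = (\<integral>z. (\<Sum>i<2. (fst z t i - snd z t i)\<^sup>2) \<partial>J)"
      using e_int[OF that] by (simp add: e_def lessThan_2)
    also have "\<dots> \<le> 3"
      using sum_nn[OF that] that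
      by (subst integral_eq_nn_integral) (auto simp: sum_nonneg intro: enn2real_leI)
    finally show ?thesis .
  qed
  have e_nonneg: "0 \<le> e t i" for t i by (simp add: e_def)
  \<comment> \<open>The innovation w of time t + 1 is orthogonal to the error u - y of time t.\<close>
  have r2: "has_bochner_integral J (\<lambda>z. (fst z t 1 - snd z t 1 - (fst z (Suc t) 0 - fst z t 1))\<^sup>2) (e t 1 + 1)"
    if t: "Suc t < N" for t
  proof (rule has_bochner_integral_nn_real)
    have t': "t < N" using t by simp
    have "(\<integral>\<^sup>+z. ennreal ((fst z t 1 - snd z t 1)\<^sup>2) \<partial>J) = ennreal (e t 1)"
      using e_int[OF t', of 1] by (simp add: e_def nn_integral_eq_integral)
    then show "(\<integral>\<^sup>+z. ennreal ((fst z t 1 - snd z t 1 - (fst z (Suc t) 0 - fst z t 1))\<^sup>2) \<partial>J) = ennreal (e t 1 + 1)"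
      using nn_integral_innovation_flip[OF K t, folded J_def] t t' w2_nn[OF t] e_nonneg[of t 1]
        nn_integral_square_add[of "\<lambda>z. fst z t 1 - snd z t 1" J "\<lambda>z. fst z (Suc t) 0 - fst z t 1"]
      by simp
  qed (use t e_nonneg in auto)
  \<comment> \<open>Under the optimal scheme y = z, and the posterior means of u and w are y and 0.\<close>
  define h where "h z = (\<Prod>t<n. lik_ratio 2 ((snd z t 1 + snd z (Suc t) 0) / 2) (fst z t 1)
      * lik_ratio 1 ((snd z (Suc t) 0 - snd z t 1) / 2) (fst z (Suc t) 0 - fst z t 1))"
    for z :: "trajectory \<times> trajectory"
  have h_meas [measurable]: "h \<in> borel_measurable (T \<Otimes>\<^sub>M T)"
    unfolding h_def
    by (intro borel_measurable_prod borel_measurable_times lik_ratio_measurable) (auto simp: N_def)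
  have h_pos: "0 < h z" for z
    unfolding h_def by (intro prod_pos mult_pos_pos ballI lik_ratio_pos) auto
  have h_le: "(\<integral>\<^sup>+x. ennreal (h (x, y)) \<partial>distr J T fst) \<le> 1" if "y \<in> space T" for y
  proof -
    \<comment> \<open>The factors sorted by noise component; w_0 and u_n occur in no pair and get the factor 1.\<close>
    define q where "q t i s = (if i = 0
        then (if t = 0 then 1 else lik_ratio 1 ((y t 0 - y (t - 1) 1) / 2) s)
        else (if t < n then lik_ratio 2 ((y t 1 + y (Suc t) 0) / 2) s else 1))" for t i :: nat and s
    have "(\<lambda>x. h (x, y)) \<in> borel_measurable T"
      using measurable_Pair1[OF h_meas that] .
    then have "(\<integral>\<^sup>+x. ennreal (h (x, y)) \<partial>distr J T fst) = (\<integral>\<^sup>+\<omega>. ennreal (h (state_path N \<omega>, y)) \<partial>noises N)"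
      unfolding fst_J by (intro nn_integral_gm_law) (auto simp: T_def)
    also have "\<dots> = (\<integral>\<^sup>+\<omega>. (\<Prod>t<N. \<Prod>i<2. ennreal (q t i (\<omega> t i))) \<partial>noises N)"
    proof (rule nn_integral_cong)
      fix \<omega>
      have q_nn: "0 \<le> q t i s" for t i s
        by (simp add: q_def less_imp_le lik_ratio_pos)
      have "h (state_path N \<omega>, y) = (\<Prod>t<n. q t 1 (\<omega> t 1)) * (\<Prod>t<n. q (Suc t) 0 (\<omega> (Suc t) 0))"
        unfolding h_def prod.distrib[symmetric]
        by (intro prod.cong refl) (simp add: q_def state_path_simps N_def)
      also have "\<dots> = (\<Prod>t<N. q t 1 (\<omega> t 1)) * (\<Prod>t<N. q t 0 (\<omega> t 0))"
        unfolding N_def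
        by (subst prod.lessThan_Suc_shift[of "\<lambda>t. q t 0 (\<omega> t 0)"]) (simp add: q_def)
      also have "\<dots> = (\<Prod>t<N. \<Prod>i<2. q t i (\<omega> t i))"
        by (simp add: lessThan_2 prod.distrib mult.commute)
      finally show "ennreal (h (state_path N \<omega>, y)) = (\<Prod>t<N. \<Prod>i<2. ennreal (q t i (\<omega> t i)))"
        by (simp add: prod_ennreal q_nn prod_nonneg)
    qed
    also have "\<dots> = 1"
    proof (rule nn_integral_noises_prod)
      show "(\<lambda>s. ennreal (q t i s)) \<in> borel_measurable borel" for t i
        unfolding q_def by measurable
      show "(\<integral>\<^sup>+s. ennreal (q t i s) \<partial>centered_normal (real (Suc i))) = 1" if "i < 2" for t i
      proof -
        have "i = 0 \<or> i = 1" using that by auto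
        then show ?thesis
          using nn_integral_lik_ratio[of 1] nn_integral_lik_ratio[of 2]
            prob_space.emeasure_space_1[OF prob_space_centered_normal]
          by (cases "t = 0"; cases "t < n") (auto simp: q_def)
      qed
    qed
    finally show ?thesis by simp
  qed
  have ln_h: "ln (h z) = (\<Sum>t<n. ln 2 / 2 + (fst z t 1)\<^sup>2 / 4 + (fst z (Suc t) 0 - fst z t 1)\<^sup>2 / 2
      - (fst z (Suc t) 0 - snd z (Suc t) 0)\<^sup>2 / 4
      - (fst z t 1 - snd z t 1 - (fst z (Suc t) 0 - fst z t 1))\<^sup>2 / 4)" for z
  proof -
    have factor: "ln (lik_ratio 2 ((y + z) / 2) u * lik_ratio 1 ((z - y) / 2) w)
        = ln 2 / 2 + u\<^sup>2 / 4 + w\<^sup>2 / 2 - (w + u - z)\<^sup>2 / 4 - (u - y - w)\<^sup>2 / 4" for u w y z :: real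
    proof -
      have "(u - (y + z) / 2)\<^sup>2 / 2 + (w - (z - y) / 2)\<^sup>2 / 2 = (w + u - z)\<^sup>2 / 4 + (u - y - w)\<^sup>2 / 4"
        by (simp add: power2_eq_square field_simps)
      then show ?thesis
        using lik_ratio_pos[of 2 "(y + z) / 2" u] lik_ratio_pos[of 1 "(z - y) / 2" w]
        by (simp add: ln_mult ln_lik_ratio)
    qed
    have "ln (h z) = (\<Sum>t<n. ln (lik_ratio 2 ((snd z t 1 + snd z (Suc t) 0) / 2) (fst z t 1)
      * lik_ratio 1 ((snd z (Suc t) 0 - snd z t 1) / 2) (fst z (Suc t) 0 - fst z t 1)))"
      unfolding h_def by (rule ln_prod) (auto intro!: mult_pos_pos lik_ratio_pos less_imp_neq[symmetric])
    then show ?thesis unfolding factor by simp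
  qed
  have "has_bochner_integral J (\<lambda>z. ln (h z))
      (\<Sum>t<n. ln 2 / 2 + 2 / 4 + 1 / 2 - e (Suc t) 0 / 4 - (e t 1 + 1) / 4)"
    unfolding ln_h
  proof (rule has_bochner_integral_sum)
    fix t assume "t \<in> {..<n}"
    then have t: "t < N" "Suc t < N" by (auto simp: N_def)
    note div = has_bochner_integral_divide_zero[rotated]
    have "has_bochner_integral J (\<lambda>_. ln 2 / 2) (ln 2 / 2)"
      by (simp add: has_bochner_integral_iff J.prob_space)
    from has_bochner_integral_diff[OF has_bochner_integral_diff[OF has_bochner_integral_add[OF
          has_bochner_integral_add[OF this div[OF u2[OF t(1)], of 4]] div[OF w2[OF t(2)], of 2]]
          div[OF e_bh[OF t(2), of 0], of 4]] div[OF r2[OF t(2)], of 4]]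
    show "has_bochner_integral J (\<lambda>z. ln 2 / 2 + (fst z t 1)\<^sup>2 / 4
        + (fst z (Suc t) 0 - fst z t 1)\<^sup>2 / 2 - (fst z (Suc t) 0 - snd z (Suc t) 0)\<^sup>2 / 4
        - (fst z t 1 - snd z t 1 - (fst z (Suc t) 0 - fst z t 1))\<^sup>2 / 4)
      (ln 2 / 2 + 2 / 4 + 1 / 2 - e (Suc t) 0 / 4 - (e t 1 + 1) / 4)"
      by simp
  qed
  then have int: "integrable J (\<lambda>z. ln (h z))" and
    eq: "(\<integral>z. ln (h z) \<partial>J) = (\<Sum>t<n. ln 2 / 2 + 2 / 4 + 1 / 2 - e (Suc t) 0 / 4 - (e t 1 + 1) / 4)"
    by (auto simp: has_bochner_integral_iff)
  have "real n * ln 2 / 2 - 3 / 4 \<le> (\<integral>z. ln (h z) \<partial>J)"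
  proof -
    have "(\<Sum>t<n. e (Suc t) 0) + (\<Sum>t<n. e t 1) \<le> (\<Sum>t<N. e t 0) + (\<Sum>t<N. e t 1)"
      unfolding N_def using e_nonneg
      by (subst sum.lessThan_Suc_shift[of "\<lambda>t. e t 0"]) simp
    also have "\<dots> = (\<Sum>t<N. e t 0 + e t 1)" by (simp add: sum.distrib)
    also have "\<dots> \<le> (\<Sum>t<N. 3)" by (intro sum_mono e_le) simp
    also have "\<dots> = 3 * real n + 3" by (simp add: N_def)
    finally have le: "(\<Sum>t<n. e (Suc t) 0) + (\<Sum>t<n. e t 1) \<le> 3 * real n + 3" .
    have "(\<integral>z. ln (h z) \<partial>J) = (\<Sum>t<n. (ln 2 / 2 + 3 / 4) - (e (Suc t) 0 + e t 1) / 4)"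
      unfolding eq by (intro sum.cong refl) (simp add: field_simps)
    also have "\<dots> = real n * (ln 2 / 2 + 3 / 4) - ((\<Sum>t<n. e (Suc t) 0) + (\<Sum>t<n. e t 1)) / 4"
      by (simp add: sum_subtractf sum.distrib sum_divide_distrib[symmetric])
    finally show ?thesis using le by (simp add: field_simps)
  qed
  then have "(real n * ln 2 / 2 - 3 / 4) / ln b \<le> (\<integral>z. ln (h z) \<partial>J) / ln b"
    using b by (intro divide_right_mono) auto
  also have "ereal \<dots> \<le> mutual_info b T T J"
    by (rule mutual_info_ge[OF b prob_J sets_J h_meas h_pos h_le int])
  finally show ?thesis by (simp add: T_def J_def N_def)
qed

section \<open>An optimal causal reconstruction\<close>

text \<open>
The backward and the forward description of the test channel: if the input is \<open>N(0, 2)\<close> and the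
output, given the input \<open>u\<close>, is \<open>N(u/2, 1/2)\<close>, then the output is \<open>N(0, 1)\<close> and the input, given
the output \<open>s\<close>, is \<open>N(s, 1)\<close>.  By Bayes' rule the same ratio is the density of the conditional
law of the output relative to its marginal.
\<close>

lemma nn_integral_test_channel:
  assumes [measurable]: "g \<in> borel_measurable borel"
  shows "(\<integral>\<^sup>+s. g (u / 2 + s) \<partial>centered_normal (1 / 2))
    = (\<integral>\<^sup>+s. g s * ennreal (lik_ratio 2 s u) \<partial>centered_normal 1)"
proof -
  have dens: "normal_density 0 (sqrt (1 / 2)) (- (u / 2) + s) = normal_density 0 1 s * lik_ratio 2 s u" for s
  proof -
    have s2: "sqrt (2 * pi) * (sqrt (2 * pi) * c) = 2 * pi * c" for c
      by (simp flip: mult.assoc)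
    have "sqrt (2 * pi) * sqrt (2 * pi) = 2 * pi" by simp
    then have c: "1 / sqrt pi = 1 / sqrt (2 * pi) * (1 / sqrt (2 * pi) / (1 / sqrt (2 * pi * 2)))"
      by (simp add: real_sqrt_mult field_simps)
    have "- (- (u / 2) + s)\<^sup>2 = - s\<^sup>2 / 2 + (- (u - s)\<^sup>2 / 2 - - u\<^sup>2 / 4)"
      by (simp add: power2_eq_square field_simps)
    then have e: "exp (- (- (u / 2) + s)\<^sup>2) = exp (- s\<^sup>2 / 2) * (exp (- (u - s)\<^sup>2 / 2) / exp (- u\<^sup>2 / 4))"
      by (simp only: exp_add exp_diff)
    have "normal_density 0 (sqrt (1 / 2)) (- (u / 2) + s) = 1 / sqrt pi * exp (- (- (u / 2) + s)\<^sup>2)"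
      by (simp add: normal_density_def power2_eq_square)
    also have "\<dots> = normal_density 0 1 s * lik_ratio 2 s u"
      unfolding c e by (simp add: normal_density_def lik_ratio_def s2)
    finally show ?thesis .
  qed
  have "(\<integral>\<^sup>+s. g (u / 2 + s) \<partial>centered_normal (1 / 2))
      = (\<integral>\<^sup>+s. ennreal (normal_density 0 (sqrt (1 / 2)) s) * g (u / 2 + s) \<partial>lborel)"
    by (rule nn_integral_centered_normal) measurable
  also have "\<dots> = (\<integral>\<^sup>+s. ennreal (normal_density 0 (sqrt (1 / 2)) (- (u / 2) + s)) * g s \<partial>lborel)"
    by (subst nn_integral_real_affine[where c = 1 and t = "- (u / 2)"]) simp_all
  also have "\<dots> = (\<integral>\<^sup>+s. ennreal (normal_density 0 (sqrt 1) s) * (g s * ennreal (lik_ratio 2 s u)) \<partial>lborel)"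
    unfolding dens by (intro nn_integral_cong) (simp add: ennreal_mult lik_ratio_pos less_imp_le mult_ac)
  also have "\<dots> = (\<integral>\<^sup>+s. g s * ennreal (lik_ratio 2 s u) \<partial>centered_normal 1)"
    by (rule nn_integral_centered_normal[symmetric]) measurable
  finally show ?thesis .
qed

text \<open>
The first coordinate repeats the previous second coordinate, which is the best prediction of the
first source coordinate from the past reconstructions.
\<close>

definition repro_vec :: "nat \<Rightarrow> trajectory \<Rightarrow> real \<Rightarrow> point" where
  "repro_vec t y s = (\<lambda>i\<in>{..<2}. if i = 0 then (if t = 0 then 0 else y (t - 1) 1) else s)"

definition scheme :: "nat \<Rightarrow> trajectory \<times> trajectory \<Rightarrow> point measure" where
  "scheme t = (\<lambda>(y, x). distr (centered_normal (1 / 2)) (vec_space 2) (\<lambda>s. repro_vec t y (x t 1 / 2 + s)))"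

definition outputs :: "nat \<Rightarrow> (nat \<Rightarrow> real) measure" where
  "outputs N = PiM {..<N} (\<lambda>_. centered_normal 1)"

definition repro :: "nat \<Rightarrow> (nat \<Rightarrow> real) \<Rightarrow> trajectory" where
  "repro N \<eta> = (\<lambda>t\<in>{..<N}. \<lambda>i\<in>{..<2}. if i = 0 then (if t = 0 then 0 else \<eta> (t - 1)) else \<eta> t)"

lemma repro_Suc: "repro (Suc t) (\<eta>(t := s)) = (repro t \<eta>)(t := repro_vec t (repro t \<eta>) s)"
  by (auto simp: repro_def repro_vec_def fun_eq_iff)

lemma repro_simps:
  "t < N \<Longrightarrow> repro N \<eta> t (Suc 0) = \<eta> t"
  "Suc t < N \<Longrightarrow> repro N \<eta> (Suc t) 0 = \<eta> t"
  "0 < N \<Longrightarrow> repro N \<eta> 0 0 = 0"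
  by (simp_all add: repro_def)

interpretation std_seq: product_prob_space "\<lambda>_::nat. centered_normal 1" UNIV
  by (auto simp: product_prob_space_def product_prob_space_axioms_def product_sigma_finite_def
      intro!: prob_space_imp_sigma_finite prob_space_centered_normal)

lemma prob_space_outputs: "prob_space (outputs N)"
  unfolding outputs_def by (intro prob_space_PiM prob_space_centered_normal) simp

lemma outputs_component [measurable]: "t < N \<Longrightarrow> (\<lambda>\<eta>. \<eta> t) \<in> borel_measurable (outputs N)"
  unfolding outputs_def
  using measurable_component_singleton[of t "{..<N}" "\<lambda>_. centered_normal 1"] by simp

lemma repro_measurable [measurable]: "repro N \<in> outputs N \<rightarrow>\<^sub>M traj_space 2 N"
proof -
  have "(\<lambda>\<eta>. if i = 0 then (if t = 0 then 0 else \<eta> (t - 1)) else \<eta> t) \<in> borel_measurable (outputs N)"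
    if "t < N" for t and i :: nat
    using that by (cases "i = 0"; cases "t = 0") auto
  then have "(\<lambda>\<eta>. \<lambda>t\<in>{..<N}. \<lambda>i\<in>{..<2}. if i = 0 then (if t = 0 then 0 else \<eta> (t - 1)) else \<eta> t)
     \<in> outputs N \<rightarrow>\<^sub>M PiM {..<N} (\<lambda>_. PiM {..<2} (\<lambda>_. borel))"
    by (intro measurable_restrict) auto
  then show ?thesis unfolding repro_def[abs_def] by (simp add: traj_space_def vec_space_def)
qed

lemma repro_vec_measurable:
  assumes "f \<in> M \<rightarrow>\<^sub>M traj_space 2 t" "g \<in> borel_measurable M"
  shows "(\<lambda>z. repro_vec t (f z) (g z)) \<in> M \<rightarrow>\<^sub>M vec_space 2"
proof -
  have "(\<lambda>z. f z (t - 1) 1) \<in> borel_measurable M" if "t \<noteq> 0"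
    by (rule measurable_compose[OF assms(1) noises_component]) (use that in auto)
  then have "(\<lambda>z. if i = 0 then (if t = 0 then 0 else f z (t - 1) 1) else g z) \<in> borel_measurable M" for i :: nat
    using assms(2) by (cases "i = 0"; cases "t = 0") auto
  then show ?thesis
    unfolding repro_vec_def vec_space_def by (intro measurable_restrict) auto
qed

lemma scheme_causal: "scheme \<in> causal_kernels 2 N"
  unfolding causal_kernels_def
proof (intro CollectI allI impI)
  fix t assume "t < N"
  let ?M = "traj_space 2 t \<Otimes>\<^sub>M traj_space 2 (Suc t)"
  have "(\<lambda>z. snd (fst z) t 1) \<in> borel_measurable (?M \<Otimes>\<^sub>M borel)"
    by (rule measurable_compose[OF measurable_compose[OF measurable_fst measurable_snd] noises_component]) auto
  note [measurable] = this
  have "(\<lambda>z. repro_vec t (fst (fst z)) (snd (fst z) t 1 / 2 + snd z)) \<in> ?M \<Otimes>\<^sub>M borel \<rightarrow>\<^sub>M vec_space 2"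
    by (intro repro_vec_measurable) measurable
  then show "scheme t \<in> ?M \<rightarrow>\<^sub>M prob_algebra (vec_space 2)"
    unfolding scheme_def case_prod_beta'
    by (intro measurable_distr_prob_space2[where M = borel])
      (auto simp: case_prod_beta' space_prob_algebra prob_space_centered_normal)
qed

text \<open>
The iterated kernels only append independent channel outputs, so an induction over time turns the
conditional law of the reconstruction into a reweighting of independent standard normal outputs.
\<close>

lemma nn_integral_scheme:
  assumes x: "x \<in> space (traj_space 2 N)" and "t \<le> N"
    and "g \<in> borel_measurable (traj_space 2 t)"
  shows "(\<integral>\<^sup>+y. g y \<partial>causal_law 2 scheme x t)
    = (\<integral>\<^sup>+\<eta>. g (repro t \<eta>) * (\<Prod>s<t. ennreal (lik_ratio 2 (\<eta> s) (x s 1))) \<partial>outputs t)"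
  using assms(2,3)
proof (induction t arbitrary: g)
  case 0
  have "repro 0 \<eta> = (\<lambda>_. undefined)" for \<eta> by (auto simp: repro_def fun_eq_iff)
  then show ?case
    using 0 by (simp add: nn_integral_return undefined_traj_space_0 prob_space.emeasure_space_1[OF prob_space_outputs])
next
  case (Suc t)
  then have t: "t < N" "t \<le> N" by auto
  note [measurable] = Suc.prems(2)
  define G where "G y = (\<integral>\<^sup>+s. g (y(t := repro_vec t y s)) * ennreal (lik_ratio 2 s (x t 1)) \<partial>centered_normal 1)" for y
  have upd: "(\<lambda>z. (fst z)(t := repro_vec t (fst z) (snd z))) \<in> traj_space 2 t \<Otimes>\<^sub>M borel \<rightarrow>\<^sub>M traj_space 2 (Suc t)"
    using measurable_compose[OF measurable_Pair[OF measurable_fst repro_vec_measurable[OF measurable_fst measurable_snd]] traj_update]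
    by (simp add: case_prod_beta')
  have G_meas: "G \<in> borel_measurable (traj_space 2 t)"
  proof -
    have "(\<lambda>z. g ((fst z)(t := repro_vec t (fst z) (snd z))) * ennreal (lik_ratio 2 (snd z) (x t 1)))
        \<in> borel_measurable (traj_space 2 t \<Otimes>\<^sub>M borel)"
    proof (rule borel_measurable_times_ennreal)
      show "(\<lambda>z. g ((fst z)(t := repro_vec t (fst z) (snd z)))) \<in> borel_measurable (traj_space 2 t \<Otimes>\<^sub>M borel)"
        by (rule measurable_compose[OF upd Suc.prems(2)])
    qed measurable
    then have "(\<lambda>z. g ((fst z)(t := repro_vec t (fst z) (snd z))) * ennreal (lik_ratio 2 (snd z) (x t 1)))
        \<in> borel_measurable (traj_space 2 t \<Otimes>\<^sub>M centered_normal 1)"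
      by (subst measurable_cong_sets[OF sets_pair_measure_cong[OF refl sets_centered_normal] refl])
    then show ?thesis
      unfolding G_def
      by (intro sigma_finite_measure.borel_measurable_nn_integral
          prob_space_imp_sigma_finite prob_space_centered_normal) (simp_all add: case_prod_beta')
  qed
  have "(\<integral>\<^sup>+y. g y \<partial>causal_law 2 scheme x (Suc t))
      = (\<integral>\<^sup>+y. \<integral>\<^sup>+v. g (y(t := v)) \<partial>scheme t (y, restrict x {..<Suc t}) \<partial>causal_law 2 scheme x t)"
    by (rule nn_integral_causal_law_Suc[OF scheme_causal t(1) x Suc.prems(2)])
  also have "\<dots> = (\<integral>\<^sup>+y. G y \<partial>causal_law 2 scheme x t)"
  proof (rule nn_integral_cong)
    fix y assume "y \<in> space (causal_law 2 scheme x t)"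
    then have y: "y \<in> space (traj_space 2 t)"
      using sets_eq_imp_space_eq[OF sets_causal_law[OF scheme_causal t(2) x]] by simp
    have r: "repro_vec t y \<in> borel \<rightarrow>\<^sub>M vec_space 2"
      by (rule repro_vec_measurable) (simp_all add: y)
    then have gr: "(\<lambda>s. g (y(t := repro_vec t y s))) \<in> borel_measurable borel"
      by (rule measurable_compose[OF measurable_compose[OF _ traj_update_single[OF y]] Suc.prems(2)])
    have shift: "(\<lambda>s. c + s) \<in> centered_normal (1 / 2) \<rightarrow>\<^sub>M borel" for c :: real
      unfolding measurable_centered_normal by measurable
    from measurable_compose[OF shift r]
    have r': "(\<lambda>s. repro_vec t y (x t 1 / 2 + s)) \<in> centered_normal (1 / 2) \<rightarrow>\<^sub>M vec_space 2" .
    have gu: "(\<lambda>v. g (y(t := v))) \<in> borel_measurable (vec_space 2)"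
      by (rule measurable_compose[OF traj_update_single[OF y] Suc.prems(2)])
    have "(\<integral>\<^sup>+v. g (y(t := v)) \<partial>scheme t (y, restrict x {..<Suc t}))
        = (\<integral>\<^sup>+s. g (y(t := repro_vec t y (x t 1 / 2 + s))) \<partial>centered_normal (1 / 2))"
      unfolding scheme_def prod.case restrict_apply'[OF lessThan_iff[THEN iffD2, OF lessI]]
      by (rule nn_integral_distr[OF r']) (simp only: measurable_distr_eq1 gu)
    also have "\<dots> = G y"
      unfolding G_def by (rule nn_integral_test_channel[OF gr])
    finally show "(\<integral>\<^sup>+v. g (y(t := v)) \<partial>scheme t (y, restrict x {..<Suc t})) = G y" .
  qed
  also have "\<dots> = (\<integral>\<^sup>+\<eta>. G (repro t \<eta>) * (\<Prod>s<t. ennreal (lik_ratio 2 (\<eta> s) (x s 1))) \<partial>outputs t)"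
    by (rule Suc.IH[OF t(2) G_meas])
  also have "\<dots> = (\<integral>\<^sup>+\<eta>. \<integral>\<^sup>+s. g (repro (Suc t) (\<eta>(t := s)))
      * (\<Prod>r<Suc t. ennreal (lik_ratio 2 ((\<eta>(t := s)) r) (x r 1))) \<partial>centered_normal 1 \<partial>outputs t)"
  proof (rule nn_integral_cong)
    fix \<eta> assume "\<eta> \<in> space (outputs t)"
    then have y: "repro t \<eta> \<in> space (traj_space 2 t)" by (rule measurable_space[OF repro_measurable])
    have "(\<lambda>s. g ((repro t \<eta>)(t := repro_vec t (repro t \<eta>) s))) \<in> borel_measurable borel"
      using measurable_compose[OF measurable_Pair2[OF upd y] Suc.prems(2)] by (simp only: fst_conv snd_conv)
    then have m: "(\<lambda>s. g ((repro t \<eta>)(t := repro_vec t (repro t \<eta>) s)) * ennreal (lik_ratio 2 s (x t 1)))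
        \<in> borel_measurable (centered_normal 1)"
      by simp
    show "G (repro t \<eta>) * (\<Prod>s<t. ennreal (lik_ratio 2 (\<eta> s) (x s 1)))
        = (\<integral>\<^sup>+s. g (repro (Suc t) (\<eta>(t := s)))
          * (\<Prod>r<Suc t. ennreal (lik_ratio 2 ((\<eta>(t := s)) r) (x r 1))) \<partial>centered_normal 1)"
      unfolding G_def nn_integral_multc[OF m, symmetric] repro_Suc
      by (intro nn_integral_cong) (simp add: mult_ac)
  qed
  also have "\<dots> = (\<integral>\<^sup>+\<eta>. g (repro (Suc t) \<eta>) * (\<Prod>r<Suc t. ennreal (lik_ratio 2 (\<eta> r) (x r 1))) \<partial>outputs (Suc t))"
  proof -
    have "(\<lambda>\<eta>. g (repro (Suc t) \<eta>) * (\<Prod>r<Suc t. ennreal (lik_ratio 2 (\<eta> r) (x r 1))))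
        \<in> borel_measurable (outputs (Suc t))"
      by measurable
    then show ?thesis
      unfolding outputs_def lessThan_Suc by (intro std_seq.product_nn_integral_insert[symmetric]) auto
  qed
  finally show ?case .
qed

lemma nn_integral_scheme_output:
  assumes x: "x \<in> space (traj_space 2 N)" and t: "t < N"
    and [measurable]: "\<phi> \<in> borel_measurable borel"
  shows "(\<integral>\<^sup>+\<eta>. \<phi> (\<eta> t) * (\<Prod>s<N. ennreal (lik_ratio 2 (\<eta> s) (x s 1))) \<partial>outputs N)
    = (\<integral>\<^sup>+r. \<phi> (x t 1 / 2 + r) \<partial>centered_normal (1 / 2))"
proof -
  let ?f = "\<lambda>s r. (if s = t then \<phi> r else 1) * ennreal (lik_ratio 2 r (x s 1))"
  have one: "(\<integral>\<^sup>+r. ennreal (lik_ratio 2 r u) \<partial>centered_normal 1) = 1" for u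
    using nn_integral_test_channel[of "\<lambda>_. 1" u]
      prob_space.emeasure_space_1[OF prob_space_centered_normal[of "1 / 2"]] by simp
  have "(\<integral>\<^sup>+\<eta>. \<phi> (\<eta> t) * (\<Prod>s<N. ennreal (lik_ratio 2 (\<eta> s) (x s 1))) \<partial>outputs N)
      = (\<integral>\<^sup>+\<eta>. (\<Prod>s<N. ?f s (\<eta> s)) \<partial>outputs N)"
    using t by (simp add: prod.distrib prod.delta)
  also have "\<dots> = (\<Prod>s<N. \<integral>\<^sup>+r. ?f s r \<partial>centered_normal 1)"
    unfolding outputs_def by (rule std_seq.product_nn_integral_prod) auto
  also have "\<dots> = (\<Prod>s<N. if s = t then (\<integral>\<^sup>+r. \<phi> (x t 1 / 2 + r) \<partial>centered_normal (1 / 2)) else 1)"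
    by (intro prod.cong refl) (simp add: nn_integral_test_channel one)
  also have "\<dots> = (\<integral>\<^sup>+r. \<phi> (x t 1 / 2 + r) \<partial>centered_normal (1 / 2))"
    using t by (simp add: prod.delta)
  finally show ?thesis .
qed

lemma nn_integral_scheme_square:
  assumes x: "x \<in> space (traj_space 2 N)" and t: "t < N"
  shows "(\<integral>\<^sup>+y. ennreal ((c - y t 1)\<^sup>2) \<partial>causal_law 2 scheme x N) = ennreal ((c - x t 1 / 2)\<^sup>2 + 1 / 2)"
    and "Suc t < N \<Longrightarrow>
      (\<integral>\<^sup>+y. ennreal ((c - y (Suc t) 0)\<^sup>2) \<partial>causal_law 2 scheme x N) = ennreal ((c - x t 1 / 2)\<^sup>2 + 1 / 2)"
proof -
  have "(\<integral>\<^sup>+\<eta>. ennreal ((c - \<eta> t)\<^sup>2) * (\<Prod>s<N. ennreal (lik_ratio 2 (\<eta> s) (x s 1))) \<partial>outputs N)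
      = (\<integral>\<^sup>+r. ennreal ((c - (x t 1 / 2 + r))\<^sup>2) \<partial>centered_normal (1 / 2))"
    by (rule nn_integral_scheme_output[OF x t]) measurable
  also have "\<dots> = ennreal ((c - x t 1 / 2)\<^sup>2 + 1 / 2)"
    using nn_integral_centered_normal_square[of "1 / 2" "c - x t 1 / 2"] by (simp add: diff_diff_eq)
  finally have *: "(\<integral>\<^sup>+\<eta>. ennreal ((c - \<eta> t)\<^sup>2) * (\<Prod>s<N. ennreal (lik_ratio 2 (\<eta> s) (x s 1))) \<partial>outputs N)
      = ennreal ((c - x t 1 / 2)\<^sup>2 + 1 / 2)" .
  show "(\<integral>\<^sup>+y. ennreal ((c - y t 1)\<^sup>2) \<partial>causal_law 2 scheme x N) = ennreal ((c - x t 1 / 2)\<^sup>2 + 1 / 2)"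
    using t by (subst nn_integral_scheme[OF x order.refl]) (use * in \<open>simp_all add: repro_simps\<close>)
  assume "Suc t < N"
  then show "(\<integral>\<^sup>+y. ennreal ((c - y (Suc t) 0)\<^sup>2) \<partial>causal_law 2 scheme x N) = ennreal ((c - x t 1 / 2)\<^sup>2 + 1 / 2)"
    by (subst nn_integral_scheme[OF x order.refl]) (use * in \<open>simp_all add: repro_simps\<close>)
qed

lemma nn_integral_half_square:
  assumes "t < N"
  shows "(\<integral>\<^sup>+\<omega>. ennreal ((\<omega> t 1 / 2)\<^sup>2) \<partial>noises N) = ennreal (1 / 2)"
proof -
  have "(\<integral>\<^sup>+\<omega>. ennreal ((\<omega> t 1 / 2)\<^sup>2) \<partial>noises N) = (\<integral>\<^sup>+\<omega>. ennreal (1 / 4) * ennreal ((\<omega> t 1)\<^sup>2) \<partial>noises N)"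
    by (intro nn_integral_cong) (simp add: ennreal_mult[symmetric] power_divide)
  also have "\<dots> = ennreal (1 / 4) * ennreal 2"
    using nn_integral_noises_square[of t N 1] assms by (subst nn_integral_cmult) auto
  also have "\<dots> = ennreal (1 / 2)" by (subst ennreal_mult[symmetric]) auto
  finally show ?thesis .
qed

text \<open>
Given the source, \<open>\<omega>\<^sub>t\<^sub>,\<^sub>1 / 2 + \<omega>\<^sub>(\<^sub>t\<^sub>+\<^sub>1\<^sub>)\<^sub>,\<^sub>0\<close> is the conditional mean of the error of the first
coordinate at time t + 1: the part of \<open>u\<^sub>t\<close> lost by the factor 1/2 of the channel, and the
innovation.
\<close>

lemma nn_integral_prediction_square:
  assumes t: "Suc t < N"
  shows "(\<integral>\<^sup>+\<omega>. ennreal ((\<omega> t 1 / 2 + \<omega> (Suc t) 0)\<^sup>2) \<partial>noises N) = ennreal (3 / 2)"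
proof -
  have t': "t < N" using t by simp
  have m1: "(\<lambda>\<omega>. \<omega> t 1 / 2) \<in> borel_measurable (noises N)"
    and m2: "(\<lambda>\<omega>. \<omega> (Suc t) 0) \<in> borel_measurable (noises N)"
    using t t' by measurable
  have m3: "(\<lambda>\<omega>. ennreal ((\<omega> t 1 / 2 - \<omega> (Suc t) 0)\<^sup>2)) \<in> borel_measurable (noises N)"
    using m1 m2 by measurable
  have "(\<integral>\<^sup>+\<omega>. ennreal ((\<omega> t 1 / 2 - \<omega> (Suc t) 0)\<^sup>2) \<partial>noises N)
      = (\<integral>\<^sup>+\<omega>. ennreal ((\<omega> t 1 / 2 - \<omega> (Suc t) 0)\<^sup>2) \<partial>distr (noises N) (noises N) (flip_innovation (Suc t)))"
    by (simp add: distr_flip_innovation[OF t])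
  also have "\<dots> = (\<integral>\<^sup>+\<omega>. ennreal ((flip_innovation (Suc t) \<omega> t 1 / 2 - flip_innovation (Suc t) \<omega> (Suc t) 0)\<^sup>2) \<partial>noises N)"
    by (rule nn_integral_distr[OF flip_innovation_measurable[OF t]]) (simp only: measurable_distr_eq1 m3)
  also have "\<dots> = (\<integral>\<^sup>+\<omega>. ennreal ((\<omega> t 1 / 2 + \<omega> (Suc t) 0)\<^sup>2) \<partial>noises N)"
    by (simp add: flip_innovation_def)
  finally have "(\<integral>\<^sup>+\<omega>. ennreal ((\<omega> t 1 / 2 + \<omega> (Suc t) 0)\<^sup>2) \<partial>noises N)
      = (\<integral>\<^sup>+\<omega>. ennreal ((\<omega> t 1 / 2)\<^sup>2) \<partial>noises N) + (\<integral>\<^sup>+\<omega>. ennreal ((\<omega> (Suc t) 0)\<^sup>2) \<partial>noises N)"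
    by (rule nn_integral_square_add[OF m1 m2])
  also have "\<dots> = ennreal (1 / 2) + ennreal 1"
    using nn_integral_noises_square[OF t, of 0] unfolding nn_integral_half_square[OF t'] by simp
  also have "\<dots> = ennreal (3 / 2)" by (subst ennreal_plus[symmetric]) auto
  finally show ?thesis .
qed

lemma scheme_joint_density:
  "joint_law 2 N (source N) scheme
    = density (source N \<Otimes>\<^sub>M distr (outputs N) (traj_space 2 N) (repro N))
        (\<lambda>z. ennreal (\<Prod>t<N. lik_ratio 2 (snd z t 1) (fst z t 1)))"
proof (rule measure_eqI)
  let ?T = "traj_space 2 N" and ?J = "joint_law 2 N (source N) scheme"
  define PY where "PY = distr (outputs N) ?T (repro N)"
  define f where "f z = (\<Prod>t<N. lik_ratio 2 (snd z t 1) (fst z t 1))" for z :: "trajectory \<times> trajectory"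
  note joint = joint_law_facts[OF scheme_causal gm_law_in_prob_algebra]
  interpret PX: prob_space "source N" by (rule prob_space_gm_law)
  interpret PY: prob_space PY
    unfolding PY_def by (rule prob_space.prob_space_distr[OF prob_space_outputs]) measurable
  have [measurable_cong]: "sets PY = sets ?T" by (simp add: PY_def)
  have prod_sets: "sets (source N \<Otimes>\<^sub>M PY) = sets (?T \<Otimes>\<^sub>M ?T)"
    by (intro sets_pair_measure_cong) (simp_all add: sets_gm_law PY_def)
  show "sets ?J = sets (density (source N \<Otimes>\<^sub>M distr (outputs N) ?T (repro N))
        (\<lambda>z. ennreal (\<Prod>t<N. lik_ratio 2 (snd z t 1) (fst z t 1))))"
    using joint(2) prod_sets by (simp add: PY_def)
  fix A assume "A \<in> sets ?J"
  then have A [measurable]: "A \<in> sets (?T \<Otimes>\<^sub>M ?T)" using joint(2) by simp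
  have f_meas [measurable]: "f \<in> borel_measurable (?T \<Otimes>\<^sub>M ?T)"
    unfolding f_def by measurable
  have "emeasure ?J A = (\<integral>\<^sup>+z. indicator A z \<partial>?J)"
    using joint(2) A by simp
  also have "\<dots> = (\<integral>\<^sup>+x. \<integral>\<^sup>+y. indicator A (x, y) \<partial>causal_law 2 scheme x N \<partial>source N)"
    by (rule joint(1)) measurable
  also have "\<dots> = (\<integral>\<^sup>+x. \<integral>\<^sup>+y. ennreal (f (x, y)) * indicator A (x, y) \<partial>PY \<partial>source N)"
  proof (rule nn_integral_cong)
    fix x assume "x \<in> space (source N)"
    then have x: "x \<in> space ?T" using sets_eq_imp_space_eq[OF sets_gm_law] by simp
    have fA: "(\<lambda>y. ennreal (f (x, y)) * indicator A (x, y)) \<in> borel_measurable ?T"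
      using x by measurable
    have "(\<integral>\<^sup>+y. indicator A (x, y) \<partial>causal_law 2 scheme x N)
        = (\<integral>\<^sup>+\<eta>. indicator A (x, repro N \<eta>) * (\<Prod>s<N. ennreal (lik_ratio 2 (\<eta> s) (x s 1))) \<partial>outputs N)"
      by (rule nn_integral_scheme[OF x order.refl]) (use x in measurable)
    also have "\<dots> = (\<integral>\<^sup>+\<eta>. ennreal (f (x, repro N \<eta>)) * indicator A (x, repro N \<eta>) \<partial>outputs N)"
      by (intro nn_integral_cong)
        (simp add: f_def repro_simps prod_ennreal less_imp_le lik_ratio_pos mult.commute)
    also have "\<dots> = (\<integral>\<^sup>+y. ennreal (f (x, y)) * indicator A (x, y) \<partial>PY)"
      unfolding PY_def by (rule nn_integral_distr[symmetric, OF repro_measurable]) (use fA in simp)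
    finally show "(\<integral>\<^sup>+y. indicator A (x, y) \<partial>causal_law 2 scheme x N)
        = (\<integral>\<^sup>+y. ennreal (f (x, y)) * indicator A (x, y) \<partial>PY)" .
  qed
  also have "\<dots> = (\<integral>\<^sup>+z. ennreal (f z) * indicator A z \<partial>(source N \<Otimes>\<^sub>M PY))"
    by (rule PY.nn_integral_fst) (simp add: measurable_cong_sets[OF prod_sets refl])
  also have "\<dots> = emeasure (density (source N \<Otimes>\<^sub>M PY) (\<lambda>z. ennreal (f z))) A"
    by (rule emeasure_density[symmetric]) (simp_all add: prod_sets measurable_cong_sets[OF prod_sets refl])
  finally show "emeasure ?J A = emeasure (density (source N \<Otimes>\<^sub>M distr (outputs N) ?T (repro N))
        (\<lambda>z. ennreal (\<Prod>t<N. lik_ratio 2 (snd z t 1) (fst z t 1)))) A"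
    by (simp add: PY_def f_def)
qed

lemma nn_integral_square_plus_half:
  assumes "a \<in> borel_measurable (noises N)" "0 \<le> r"
    and "(\<integral>\<^sup>+\<omega>. ennreal ((a \<omega>)\<^sup>2) \<partial>noises N) = ennreal r"
  shows "(\<integral>\<^sup>+\<omega>. ennreal ((a \<omega>)\<^sup>2 + 1 / 2) \<partial>noises N) = ennreal (r + 1 / 2)"
  using assms prob_space.emeasure_space_1[OF prob_space_noises, of N]
  by (simp add: nn_integral_add)

lemma scheme_error_1:
  assumes t: "t < N"
  shows "(\<integral>\<^sup>+z. ennreal ((fst z t 1 - snd z t 1)\<^sup>2) \<partial>joint_law 2 N (source N) scheme) = ennreal 1"
proof -
  let ?T = "traj_space 2 N"
  have [measurable]: "(\<lambda>x. x t 1) \<in> borel_measurable ?T" using t by measurable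
  have "(\<lambda>z. ennreal ((fst z t 1 - snd z t 1)\<^sup>2)) \<in> borel_measurable (?T \<Otimes>\<^sub>M ?T)"
    using t by measurable
  from joint_law_facts(1)[OF scheme_causal gm_law_in_prob_algebra this]
  have "(\<integral>\<^sup>+z. ennreal ((fst z t 1 - snd z t 1)\<^sup>2) \<partial>joint_law 2 N (source N) scheme)
      = (\<integral>\<^sup>+x. \<integral>\<^sup>+y. ennreal ((x t 1 - y t 1)\<^sup>2) \<partial>causal_law 2 scheme x N \<partial>source N)"
    by (simp only: fst_conv snd_conv)
  also have "\<dots> = (\<integral>\<^sup>+x. ennreal ((x t 1 / 2)\<^sup>2 + 1 / 2) \<partial>source N)"
    by (intro nn_integral_cong, subst nn_integral_scheme_square(1)[OF _ t])
      (simp_all add: sets_eq_imp_space_eq[OF sets_gm_law])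
  also have "\<dots> = (\<integral>\<^sup>+\<omega>. ennreal ((\<omega> t 1 / 2)\<^sup>2 + 1 / 2) \<partial>noises N)"
    using t by (subst nn_integral_gm_law) (simp_all add: state_path_simps)
  also have "\<dots> = ennreal (1 / 2 + 1 / 2)"
  proof (rule nn_integral_square_plus_half[OF _ _ nn_integral_half_square[OF t]])
    show "(\<lambda>\<omega>. \<omega> t 1 / 2) \<in> borel_measurable (noises N)" using t by measurable
  qed simp
  also have "\<dots> = ennreal 1" by simp
  finally show ?thesis .
qed

lemma scheme_error_0:
  assumes t: "t < N"
  shows "(\<integral>\<^sup>+z. ennreal ((fst z t 0 - snd z t 0)\<^sup>2) \<partial>joint_law 2 N (source N) scheme) \<le> ennreal 2"
proof -
  let ?T = "traj_space 2 N"
  have [measurable]: "(\<lambda>x. x t 0) \<in> borel_measurable ?T" using t by measurable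
  have "(\<lambda>z. ennreal ((fst z t 0 - snd z t 0)\<^sup>2)) \<in> borel_measurable (?T \<Otimes>\<^sub>M ?T)"
    using t by measurable
  from joint_law_facts(1)[OF scheme_causal gm_law_in_prob_algebra this]
  have "(\<integral>\<^sup>+z. ennreal ((fst z t 0 - snd z t 0)\<^sup>2) \<partial>joint_law 2 N (source N) scheme)
      = (\<integral>\<^sup>+x. \<integral>\<^sup>+y. ennreal ((x t 0 - y t 0)\<^sup>2) \<partial>causal_law 2 scheme x N \<partial>source N)"
    by (simp only: fst_conv snd_conv)
  also have "\<dots> \<le> ennreal 2"
  proof (cases t)
    case 0
    have "(\<integral>\<^sup>+x. \<integral>\<^sup>+y. ennreal ((x t 0 - y t 0)\<^sup>2) \<partial>causal_law 2 scheme x N \<partial>source N)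
        = (\<integral>\<^sup>+x. ennreal ((x 0 0)\<^sup>2) \<partial>source N)"
    proof (rule nn_integral_cong)
      fix x assume "x \<in> space (source N)"
      then have x: "x \<in> space ?T" by (simp add: sets_eq_imp_space_eq[OF sets_gm_law])
      have one: "(\<integral>\<^sup>+\<eta>. (\<Prod>s<N. ennreal (lik_ratio 2 (\<eta> s) (x s 1))) \<partial>outputs N) = 1"
        using nn_integral_scheme_output[OF x t, of "\<lambda>_. 1"]
          prob_space.emeasure_space_1[OF prob_space_centered_normal[of "1 / 2"]] by simp
      have "(\<integral>\<^sup>+y. ennreal ((x t 0 - y t 0)\<^sup>2) \<partial>causal_law 2 scheme x N)
          = (\<integral>\<^sup>+\<eta>. ennreal ((x 0 0)\<^sup>2) * (\<Prod>s<N. ennreal (lik_ratio 2 (\<eta> s) (x s 1))) \<partial>outputs N)"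
        using t 0 by (subst nn_integral_scheme[OF x order.refl]) (simp_all add: repro_simps)
      also have "\<dots> = ennreal ((x 0 0)\<^sup>2) *
          (\<integral>\<^sup>+\<eta>. (\<Prod>s<N. ennreal (lik_ratio 2 (\<eta> s) (x s 1))) \<partial>outputs N)"
        by (rule nn_integral_cmult) measurable
      also have "\<dots> = ennreal ((x 0 0)\<^sup>2)" by (simp only: one mult_1_right)
      finally show "(\<integral>\<^sup>+y. ennreal ((x t 0 - y t 0)\<^sup>2) \<partial>causal_law 2 scheme x N) = ennreal ((x 0 0)\<^sup>2)" .
    qed
    also have "\<dots> = (\<integral>\<^sup>+\<omega>. ennreal ((\<omega> 0 0)\<^sup>2) \<partial>noises N)"
      using t 0 by (subst nn_integral_gm_law) (simp_all add: state_path_simps)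
    also have "\<dots> \<le> ennreal 2"
      using t 0 nn_integral_noises_square[of 0 N 0] by simp
    finally show ?thesis .
  next
    case (Suc s)
    have s: "s < N" "Suc s < N" using t Suc by auto
    have [measurable]: "(\<lambda>x. x s 1) \<in> borel_measurable ?T" "(\<lambda>x. x (Suc s) 0) \<in> borel_measurable ?T"
      using s by measurable
    have "(\<integral>\<^sup>+x. \<integral>\<^sup>+y. ennreal ((x t 0 - y t 0)\<^sup>2) \<partial>causal_law 2 scheme x N \<partial>source N)
        = (\<integral>\<^sup>+x. ennreal ((x (Suc s) 0 - x s 1 / 2)\<^sup>2 + 1 / 2) \<partial>source N)"
      unfolding Suc
      by (intro nn_integral_cong, subst nn_integral_scheme_square(2)[OF _ s])
        (simp_all add: sets_eq_imp_space_eq[OF sets_gm_law])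
    also have "\<dots> = (\<integral>\<^sup>+\<omega>. ennreal ((\<omega> s 1 / 2 + \<omega> (Suc s) 0)\<^sup>2 + 1 / 2) \<partial>noises N)"
    proof -
      have "u + w - u / 2 = u / 2 + w" for u w :: real by simp
      then show ?thesis using s by (subst nn_integral_gm_law) (simp_all add: state_path_simps)
    qed
    also have "\<dots> = ennreal (3 / 2 + 1 / 2)"
    proof (rule nn_integral_square_plus_half[OF _ _ nn_integral_prediction_square[OF s(2)]])
      show "(\<lambda>\<omega>. \<omega> s 1 / 2 + \<omega> (Suc s) 0) \<in> borel_measurable (noises N)" using s by measurable
    qed simp
    also have "\<dots> = ennreal 2" by simp
    finally show ?thesis by simp
  qed
  finally show ?thesis .
qed

text \<open>
The first coordinate has error at most 2 and the second has error 1, the optimal split of 3.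
\<close>

lemma scheme_feasible:
  assumes t: "t < N"
  shows "mean_sq_error 2 t (joint_law 2 N (source N) scheme) \<le> ennreal 3"
proof -
  let ?J = "joint_law 2 N (source N) scheme" and ?T = "traj_space 2 N"
  have sets_J: "sets ?J = sets (?T \<Otimes>\<^sub>M ?T)"
    by (rule joint_law_facts(2)[OF scheme_causal gm_law_in_prob_algebra])
  have m: "(\<lambda>z. ennreal ((fst z t i - snd z t i)\<^sup>2)) \<in> borel_measurable ?J" if "i < 2" for i
    unfolding measurable_cong_sets[OF sets_J refl] using t that by measurable
  have "mean_sq_error 2 t ?J = (\<integral>\<^sup>+z. ennreal ((fst z t 0 - snd z t 0)\<^sup>2) + ennreal ((fst z t 1 - snd z t 1)\<^sup>2) \<partial>?J)"
    unfolding mean_sq_error_def by (simp add: case_prod_beta' lessThan_2)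
  also have "\<dots> = (\<integral>\<^sup>+z. ennreal ((fst z t 0 - snd z t 0)\<^sup>2) \<partial>?J) + (\<integral>\<^sup>+z. ennreal ((fst z t 1 - snd z t 1)\<^sup>2) \<partial>?J)"
    by (rule nn_integral_add[OF m m]) simp_all
  also have "\<dots> \<le> ennreal 2 + ennreal 1"
    unfolding scheme_error_1[OF t] by (intro add_right_mono scheme_error_0[OF t])
  also have "\<dots> = ennreal 3" by (subst ennreal_plus[symmetric]) auto
  finally show ?thesis .
qed

lemma scheme_mutual_info:
  assumes b: "1 < b"
  shows "mutual_info b (traj_space 2 N) (traj_space 2 N) (joint_law 2 N (source N) scheme)
    = ereal (real N * ln 2 / 2 / ln b)"
proof -
  define T where "T = traj_space 2 N"
  define J where "J = joint_law 2 N (source N) scheme"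
  define PY where "PY = distr (outputs N) T (repro N)"
  define f where "f z = (\<Prod>t<N. lik_ratio 2 (snd z t 1) (fst z t 1))" for z :: "trajectory \<times> trajectory"
  note joint = joint_law_facts[OF scheme_causal[of N] gm_law_in_prob_algebra, folded J_def T_def]
  have sets_J [measurable_cong]: "sets J = sets (T \<Otimes>\<^sub>M T)" by (rule joint(2))
  interpret J: prob_space J by (rule joint(3))
  have comp [measurable]: "(\<lambda>x. x t i) \<in> borel_measurable T" if "t < N" "i < 2" for t i
    unfolding T_def using that by measurable
  have prob_PY: "prob_space PY"
    unfolding PY_def T_def by (rule prob_space.prob_space_distr[OF prob_space_outputs]) measurable
  have sets_PY [measurable_cong]: "sets PY = sets T" by (simp add: PY_def)
  have sets_PX [measurable_cong]: "sets (source N) = sets T" by (simp add: T_def sets_gm_law)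
  have f_meas: "f \<in> borel_measurable (T \<Otimes>\<^sub>M T)" unfolding f_def by measurable
  have u2: "has_bochner_integral J (\<lambda>z. (fst z t 1)\<^sup>2) 2" if "t < N" for t
  proof (rule has_bochner_integral_nn_real)
    show "(\<integral>\<^sup>+z. ennreal ((fst z t 1)\<^sup>2) \<partial>J) = ennreal 2"
      unfolding J_def
      using that nn_integral_joint_source[OF scheme_causal, of "\<lambda>x. ennreal ((x t 1)\<^sup>2)" N] nn_integral_noises_square[of t N 1]
      by (simp add: state_path_simps)
  qed (use that in auto)
  have e2: "has_bochner_integral J (\<lambda>z. (fst z t 1 - snd z t 1)\<^sup>2) 1" if "t < N" for t
    by (rule has_bochner_integral_nn_real) (use that scheme_error_1[OF that] in \<open>auto simp: J_def[symmetric]\<close>)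
  have ln_f: "ln (f z) = (\<Sum>t<N. ln 2 / 2 + (fst z t 1)\<^sup>2 / 4 - (fst z t 1 - snd z t 1)\<^sup>2 / 2)" for z
  proof -
    have "ln (f z) = (\<Sum>t<N. ln (lik_ratio 2 (snd z t 1) (fst z t 1)))"
      unfolding f_def by (rule ln_prod) (auto intro!: lik_ratio_pos less_imp_neq[symmetric])
    then show ?thesis by (simp add: ln_lik_ratio)
  qed
  have "has_bochner_integral J (\<lambda>z. ln (f z)) (\<Sum>t<N. ln 2 / 2 + 2 / 4 - 1 / 2)"
    unfolding ln_f
  proof (rule has_bochner_integral_sum)
    fix t assume "t \<in> {..<N}"
    then have t: "t < N" by simp
    note div = has_bochner_integral_divide_zero[rotated]
    have "has_bochner_integral J (\<lambda>_. ln 2 / 2) (ln 2 / 2)"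
      by (simp add: has_bochner_integral_iff J.prob_space)
    from has_bochner_integral_diff[OF has_bochner_integral_add[OF this div[OF u2[OF t], of 4]] div[OF e2[OF t], of 2]]
    show "has_bochner_integral J (\<lambda>z. ln 2 / 2 + (fst z t 1)\<^sup>2 / 4 - (fst z t 1 - snd z t 1)\<^sup>2 / 2)
        (ln 2 / 2 + 2 / 4 - 1 / 2)"
      by simp
  qed
  then have int: "integrable J (\<lambda>z. ln (f z))" and eq: "(\<integral>z. ln (f z) \<partial>J) = real N * ln 2 / 2"
    by (auto simp: has_bochner_integral_iff)
  have f_x: "(\<integral>\<^sup>+y. ennreal (f (x, y)) \<partial>PY) = 1" if "x \<in> space (source N)" for x
  proof -
    have x: "x \<in> space (traj_space 2 N)" using that by (simp add: sets_eq_imp_space_eq[OF sets_gm_law])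
    have fx: "(\<lambda>y. ennreal (f (x, y))) \<in> borel_measurable T"
      using measurable_Pair2[OF f_meas, of x] x by (simp add: T_def)
    interpret c: prob_space "causal_law 2 scheme x N"
      by (rule prob_space_causal_law[OF scheme_causal order.refl x])
    have "(\<integral>\<^sup>+y. ennreal (f (x, y)) \<partial>PY) = (\<integral>\<^sup>+\<eta>. ennreal (f (x, repro N \<eta>)) \<partial>outputs N)"
      unfolding PY_def using fx by (intro nn_integral_distr) (simp_all add: T_def)
    also have "\<dots> = (\<integral>\<^sup>+\<eta>. 1 * (\<Prod>s<N. ennreal (lik_ratio 2 (\<eta> s) (x s 1))) \<partial>outputs N)"
      by (intro nn_integral_cong) (simp add: f_def repro_simps prod_ennreal less_imp_le lik_ratio_pos)
    also have "\<dots> = (\<integral>\<^sup>+y. 1 \<partial>causal_law 2 scheme x N)"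
      by (rule nn_integral_scheme[OF x order.refl, symmetric]) simp
    also have "\<dots> = 1" by (simp add: c.emeasure_space_1)
    finally show ?thesis .
  qed
  have f_y: "(\<integral>\<^sup>+x. ennreal (f (x, y)) \<partial>source N) = 1" if "y \<in> space PY" for y
  proof -
    have y: "y \<in> space T" using that by (simp add: PY_def)
    have "(\<lambda>x. ennreal (f (x, y))) \<in> borel_measurable T"
      using measurable_Pair1[OF f_meas y] by simp
    then have "(\<integral>\<^sup>+x. ennreal (f (x, y)) \<partial>source N) = (\<integral>\<^sup>+\<omega>. ennreal (f (state_path N \<omega>, y)) \<partial>noises N)"
      by (intro nn_integral_gm_law) (simp add: T_def)
    also have "\<dots> = (\<integral>\<^sup>+\<omega>. (\<Prod>t<N. \<Prod>i<2. (if i = 0 then 1 else ennreal (lik_ratio 2 (y t 1) (\<omega> t i)))) \<partial>noises N)"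
      by (intro nn_integral_cong)
        (simp add: f_def state_path_simps prod_ennreal less_imp_le lik_ratio_pos lessThan_2)
    also have "\<dots> = 1"
    proof (rule nn_integral_noises_prod)
      show "(\<lambda>s. if i = 0 then 1 else ennreal (lik_ratio 2 (y t 1) s)) \<in> borel_measurable borel" for t and i :: nat
        by measurable
      show "(\<integral>\<^sup>+s. (if i = 0 then 1 else ennreal (lik_ratio 2 (y t 1) s)) \<partial>centered_normal (real (Suc i))) = 1"
        if "i < 2" for t and i :: nat
      proof -
        have "i = 0 \<or> i = 1" using that by auto
        then show ?thesis
          using nn_integral_lik_ratio[of 2] prob_space.emeasure_space_1[OF prob_space_centered_normal] by auto
      qed
    qed
    finally show ?thesis .
  qed
  have "mutual_info b T T J = ereal ((\<integral>z. ln (f z) \<partial>J) / ln b)"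
  proof (rule mutual_info_density[OF b prob_space_gm_law prob_PY sets_PX sets_PY _ _ f_x f_y _ int])
    show "f \<in> borel_measurable (source N \<Otimes>\<^sub>M PY)"
      using f_meas by (simp add: measurable_cong_sets[OF sets_pair_measure_cong[OF sets_PX sets_PY] refl])
    show "0 < f z" for z unfolding f_def by (intro prod_pos ballI lik_ratio_pos) simp
    show "J = density (source N \<Otimes>\<^sub>M PY) (\<lambda>z. ennreal (f z))"
      unfolding J_def PY_def f_def T_def by (rule scheme_joint_density)
  qed
  then have "mutual_info b T T J = ereal (real N * ln 2 / 2 / ln b)" unfolding eq .
  then show ?thesis unfolding T_def J_def .
qed

section \<open>The rate-distortion limit and the formula\<close>

lemma pos_def_cov_noise_cov: "pos_def_cov 2 noise_cov"
proof -
  have mv: "noise_cov *\<^sub>v v = vec 2 (\<lambda>i. real (Suc i) * vec_index v i)" if "v \<in> carrier_vec 2" for v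
    using that by (intro eq_vecI) (auto simp: noise_cov_def mat_diag_def scalar_prod_def
        numeral_2_eq_2 less_Suc_eq)
  have "0 < scalar_prod v (noise_cov *\<^sub>v v)" if v: "v \<in> carrier_vec 2" "v \<noteq> 0\<^sub>v 2" for v :: "real vec"
  proof -
    have sp: "scalar_prod v (noise_cov *\<^sub>v v) = (vec_index v 0)\<^sup>2 + 2 * (vec_index v 1)\<^sup>2"
      unfolding mv[OF v(1)] by (simp add: scalar_prod_def numeral_2_eq_2 power2_eq_square)
    have "vec_index v 0 \<noteq> 0 \<or> vec_index v 1 \<noteq> 0"
    proof (rule ccontr)
      assume "\<not> ?thesis"
      then have "v = 0\<^sub>v 2" using v(1) by (intro eq_vecI) (auto simp: less_Suc_eq numeral_2_eq_2)
      with v(2) show False by simp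
    qed
    then show ?thesis unfolding sp
      by (auto intro: add_pos_nonneg add_nonneg_pos)
  qed
  moreover have "transpose_mat noise_cov = noise_cov"
    by (intro eq_matI) (auto simp: noise_cov_def mat_diag_def)
  ultimately show ?thesis by (simp add: pos_def_cov_def noise_cov_def mat_diag_def)
qed

lemma shift_mat_transpose: "shift_mat * transpose_mat shift_mat = mat_diag 2 (\<lambda>i. if i = 0 then 1 else 0)"
  by (intro eq_matI) (auto simp: shift_mat_def mat_diag_def scalar_prod_def numeral_2_eq_2 less_Suc_eq)

lemma spectrum_condition:
  "(3::real) / real 2 \<le> Min (spectrum ((3 / real 2) \<cdot>\<^sub>m (shift_mat * transpose_mat shift_mat) + noise_cov))"
proof -
  have "(3 / real 2) \<cdot>\<^sub>m (shift_mat * transpose_mat shift_mat) + noise_cov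
      = mat_diag 2 (\<lambda>i. if i = 0 then 5 / 2 else 2)"
    unfolding shift_mat_transpose noise_cov_def
    by (intro eq_matI) (auto simp: mat_diag_def less_Suc_eq numeral_2_eq_2)
  then show ?thesis by (simp add: spectrum_mat_diag lessThan_2)
qed

lemma formula_det: "det (shift_mat * transpose_mat shift_mat + (real 2 / 3) \<cdot>\<^sub>m noise_cov) = 20 / 9"
proof -
  have "shift_mat * transpose_mat shift_mat + (real 2 / 3) \<cdot>\<^sub>m noise_cov
      = mat_diag 2 (\<lambda>i. if i = 0 then 5 / 3 else 4 / 3)"
    unfolding shift_mat_transpose noise_cov_def
    by (intro eq_matI) (auto simp: mat_diag_def less_Suc_eq numeral_2_eq_2)
  then show ?thesis by (simp add: det_mat_diag lessThan_2)
qed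

lemma SRD_finite_le:
  assumes b: "1 < b"
  shows "SRD_finite b 2 source n 3 \<le> ereal (ln 2 / 2 / ln b)"
proof -
  have "SRD_finite b 2 source n 3 \<le> ereal (1 / (real n + 1)) *
      mutual_info b (traj_space 2 (Suc n)) (traj_space 2 (Suc n)) (joint_law 2 (Suc n) (source (Suc n)) scheme)"
    unfolding SRD_finite_def
    by (rule INF_lower) (simp add: scheme_causal scheme_feasible[unfolded ennreal_numeral] less_Suc_eq_le)
  also have "\<dots> = ereal (ln 2 / 2 / ln b)"
  proof -
    have "real n + 1 \<noteq> 0" by linarith
    then have "1 / (real n + 1) * ((real n + 1) * c) = c" for c :: real by simp
    from this[of "ln 2 / 2 / ln b"] show ?thesis
      unfolding scheme_mutual_info[OF b] by (simp add: add.commute)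
  qed
  finally show ?thesis .
qed

lemma SRD_finite_ge:
  assumes b: "1 < b"
  shows "ereal (1 / (real n + 1) * ((real n * ln 2 / 2 - 3 / 4) / ln b)) \<le> SRD_finite b 2 source n 3"
  unfolding SRD_finite_def
proof (rule INF_greatest)
  fix K assume "K \<in> {K \<in> causal_kernels 2 (Suc n).
      \<forall>t\<le>n. mean_sq_error 2 t (joint_law 2 (Suc n) (source (Suc n)) K) \<le> ennreal 3}"
  then have "ereal ((real n * ln 2 / 2 - 3 / 4) / ln b)
      \<le> mutual_info b (traj_space 2 (Suc n)) (traj_space 2 (Suc n)) (joint_law 2 (Suc n) (source (Suc n)) K)"
    by (intro converse_bound[OF b]) auto
  then have "ereal (1 / (real n + 1)) * ereal ((real n * ln 2 / 2 - 3 / 4) / ln b)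
      \<le> ereal (1 / (real n + 1)) *
        mutual_info b (traj_space 2 (Suc n)) (traj_space 2 (Suc n)) (joint_law 2 (Suc n) (source (Suc n)) K)"
    by (rule ereal_mult_left_mono) simp
  then show "ereal (1 / (real n + 1) * ((real n * ln 2 / 2 - 3 / 4) / ln b))
      \<le> ereal (1 / (real n + 1)) *
        mutual_info b (traj_space 2 (Suc n)) (traj_space 2 (Suc n)) (joint_law 2 (Suc n) (source (Suc n)) K)"
    by (simp only: times_ereal.simps)
qed

lemma has_SRD_source:
  assumes b: "1 < b"
  shows "has_SRD b 2 source 3 (ln 2 / 2 / ln b)"
proof -
  have "(\<lambda>n. 1 / (real n + 1) * ((real n * ln 2 / 2 - 3 / 4) / ln b)) \<longlonglongrightarrow> ln 2 / 2 / ln b"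
  proof -
    have "(\<lambda>n. 1 / (real n + 1) * (real n * ln 2 / 2 - 3 / 4)) \<longlonglongrightarrow> ln 2 / 2" by real_asymp
    from tendsto_divide[OF this tendsto_const[of "ln b"]] show ?thesis using b by simp
  qed
  then have lower: "(\<lambda>n. ereal (1 / (real n + 1) * ((real n * ln 2 / 2 - 3 / 4) / ln b)))
      \<longlonglongrightarrow> ereal (ln 2 / 2 / ln b)"
    by simp
  show ?thesis unfolding has_SRD_def
    by (rule tendsto_sandwich[OF always_eventually[OF allI[OF SRD_finite_ge[OF b]]]
        always_eventually[OF allI[OF SRD_finite_le[OF b]]] lower tendsto_const])
qed

theorem mainTheorem3:
  fixes b :: real
  assumes "1 < b"
  shows "\<exists>(p :: nat) (A :: real mat) (Sw :: real mat) (S0 :: real mat) (D :: real).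
    1 \<le> p \<and> A \<in> carrier_mat p p \<and> pos_def_cov p Sw \<and> pos_def_cov p S0 \<and> 0 < D \<and>
    D / real p \<le> Min (spectrum ((D / real p) \<cdot>\<^sub>m (A * transpose_mat A) + Sw)) \<and>
    (\<exists>R. has_SRD b p (gm_law p A S0 Sw) D R \<and>
         R \<noteq> 1 / 2 * log b (det (A * transpose_mat A + (real p / D) \<cdot>\<^sub>m Sw)))"
proof (intro exI conjI)
  show "has_SRD b 2 source 3 (ln 2 / 2 / ln b)" by (rule has_SRD_source[OF assms])
  show "ln 2 / 2 / ln b \<noteq> 1 / 2 * log b (det (shift_mat * transpose_mat shift_mat + (real 2 / 3) \<cdot>\<^sub>m noise_cov))"
    using assms unfolding formula_det by (simp add: log_def)
  show "shift_mat \<in> carrier_mat 2 2" by (simp add: shift_mat_def)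
qed (rule pos_def_cov_noise_cov spectrum_condition | simp)+

end
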